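(* Let $\{R_n(t)\}_{n\in\mathbb{Z}}$ be the solution of the defocusing integrable discrete nonlinear Schrödinger equation $$ i\frac{d}{dt}R_n+(R_{n+1}-2R_n+R_{n-1})-|R_n|^2(R_{n+1}+R_{n-1})=0 $$ with rapidly decreasing initial data $\{R_n(0)\}$, and let $r(z)$, $|z|=1$, be the associated reflection coefficient. Let $V_0>0$ and consider Region C: $n>(2+V_0)t$. Then for every positive integer $j$ there is a constant $C=C(j,V_0)>0$ such that $|R_n(t)|\le Cn^{-j}$ in Region C. Moreover, if $r(z)$ is analytic on the circle $|z|=1$, then there exist constants $\rho=\rho(V_0)$ with $0<\rho<1$ and $C=C(V_0)>0$ such that $|R_n(t)|\le C\rho^n$ in Region C.
   Context: Rapidly decreasing initial data: for every $s>0$ there is $C_s>0$ with $|R_n(0)|\le C_s(1+|n|)^{-s}$ for all $n\in\mathbb{Z}$. Reflection coefficient: $r(z)$ is the reflection coefficient on the unit circle $C\colon|z|=1$ obtained from $\{R_n(0)\}$ by the direct scattering transform of the (defocusing) Ablowitz–Ladik spectral problem (normalization of Ablowitz–Prinari–Trubatch). Under the decay assumption, $r$ is smooth on $C$ and $|r|<1$. The solution is recovered as $R_n(t)=-\frac{d}{dz}m_{21}(z;n,t)\big|_{z=0}$, where the $2\times2$ matrix function $m$ is analytic in $|z|\ne1$, $m\to I$ as $z\to\infty$, and $m_+=m_-v$ on $C$ ($m_+$, $m_-$ the boundary values from outside and inside), with $v=e^{-\varphi\,\mathrm{ad}\,\sigma_3}\begin{bmatrix}1-|r|^2&-\bar r\\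 r&1\end{bmatrix}$, $\varphi=\tfrac{it}{2}(z-z^{-1})^2-n\log z$, $\sigma_3=\mathrm{diag}(1,-1)$, $a^{\mathrm{ad}\,\sigma_3}Q=a^{\sigma_3}Qa^{-\sigma_3}$. "Analytic on the circle" means $r$ extends analytically to a neighborhood of $|z|=1$ (e.g. this holds if $\{R_n(0)\}$ is finitely supported).
   Formalization: The initial data is also assumed to satisfy |R_n(0)| < 1 for all n, the usual defocusing condition; without it |r| < 1 can fail (for R_n(0) = c at n = 0 and 0 elsewhere, r(z) = cz). Region C is taken with t ≥ 0. *)

theory Defs
  imports "HOL-Analysis.Analysis"
begin

text \<open>Ablowitz--Ladik spectral problem (APT normalization, defocusing case):
  X(n+1) = [[z, cnj(R n)], [R n, 1/z]] X(n).  Vectors are pairs of complex numbers.\<close>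
definition AL_eigen :: "(int \<Rightarrow> complex) \<Rightarrow> complex \<Rightarrow> (int \<Rightarrow> complex \<times> complex) \<Rightarrow> bool" where
  "AL_eigen R z X \<longleftrightarrow>
     (\<forall>n. X (n + 1) = (z * fst (X n) + cnj (R n) * snd (X n), R n * fst (X n) + snd (X n) / z))"

definition is_reflection_coefficient :: "(int \<Rightarrow> complex) \<Rightarrow> (complex \<Rightarrow> complex) \<Rightarrow> bool" where
  "is_reflection_coefficient R r \<longleftrightarrow>
     (\<forall>z. cmod z = 1 \<longrightarrow>
        (\<exists>\<phi> \<psi> \<psi>b a b.
           AL_eigen R z \<phi> \<and> AL_eigen R z \<psi> \<and> AL_eigen R z \<psi>b \<and>
           ((\<lambda>n. (z powi (-n) * fst (\<phi> n), z powi (-n) * snd (\<phi> n))) \<longlongrightarrow> (1, 0)) at_bot \<and>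
           ((\<lambda>n. (z powi n * fst (\<psi> n), z powi n * snd (\<psi> n))) \<longlongrightarrow> (0, 1)) at_top \<and>
           ((\<lambda>n. (z powi (-n) * fst (\<psi>b n), z powi (-n) * snd (\<psi>b n))) \<longlongrightarrow> (1, 0)) at_top \<and>
           (\<forall>n. \<phi> n = (a * fst (\<psi>b n) + b * fst (\<psi> n), a * snd (\<psi>b n) + b * snd (\<psi> n))) \<and>
           r z = b / a))"

definition analytic_on_circle :: "(complex \<Rightarrow> complex) \<Rightarrow> bool" where
  "analytic_on_circle r \<longleftrightarrow>
     (\<exists>S f. open S \<and> sphere 0 1 \<subseteq> S \<and> f holomorphic_on S \<and> (\<forall>z\<in>sphere 0 1. f z = r z))"

end

theory Submission
  imports Defs "HOL-Complex_Analysis.Complex_Analysis" "HOL-Real_Asymp.Real_Asymp"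
begin

text \<open>
  Instead of the Riemann--Hilbert problem, the evolution is controlled by the conservation law of the
  density \<open>- ln (1 - |R\<^sub>n|\<^sup>2)\<close>, whose flux \<open>2 Im (cnj R\<^sub>n R\<^sub>n\<^sub>+\<^sub>1)\<close> travels at speed at most 2. For \<open>n > (2 + V\<^sub>0) t\<close>
  this bounds \<open>|R\<^sub>n(t)|\<^sup>2\<close> by the tail of the initial data beyond \<open>\<eta> n\<close> plus an exponentially small term, so
  both claims reduce to the decay of \<open>R\<^sub>n(0)\<close> as \<open>n\<close> tends to \<open>+\<infinity>\<close>.

  If \<open>r\<close> is analytic on the circle, this decay is exponential. With \<open>w = 1 / z\<close>, the quotient \<open>\<phi>\<^sub>n / a\<close> extends
  holomorphically to \<open>|w| < 1\<close>, so taking the mean over the circle of the second component of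
  \<open>\<phi>\<^sub>n / a = \<psi>b\<^sub>n + r \<psi>\<^sub>n\<close>, suitably scaled, expresses \<open>R\<^sub>n\<close> as the mean of \<open>r(1/w) w\<^bsup>2n+1\<^esup> q\<^sub>n(w)\<close> with \<open>q\<^sub>n\<close>
  holomorphic in the disc and bounded uniformly in \<open>n\<close>. Shrinking the circle gives the factor \<open>\<rho>\<^bsup>2n+1\<^esup>\<close>.
\<close>

section \<open>Energy transport\<close>

text \<open>The integrating factor \<open>exp (- h)\<close> makes \<open>y * exp (- h)\<close>
  constant, so \<open>y\<close> keeps its initial sign.\<close>

lemma linear_ode_pos:
  fixes y g :: "real \<Rightarrow> real"
  assumes y: "\<And>s. s \<ge> 0 \<Longrightarrow> (y has_real_derivative g s * y s) (at s within {0..})"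
    and g: "continuous_on {0..} g" and y0: "y 0 > 0" and t: "t \<ge> 0"
  shows "y t > 0"
proof -
  define h where "h s = integral {0..s} g" for s
  have "((\<lambda>s. y s * exp (- h s)) has_real_derivative 0) (at s within {0..t})"
    if "s \<in> {0..t}" for s
  proof -
    have "(h has_real_derivative g s) (at s within {0..t})"
      unfolding h_def using that g
      by (intro integral_has_real_derivative) (auto intro: continuous_on_subset)
    moreover have "(y has_real_derivative g s * y s) (at s within {0..t})"
      using y[of s] that by (auto intro: DERIV_subset)
    ultimately show ?thesis
      by (auto intro!: derivative_eq_intros simp: algebra_simps)
  qed
  then obtain k where k: "\<And>s. s \<in> {0..t} \<Longrightarrow> y s * exp (- h s) = k"
    using has_field_derivative_zero_constant[of "{0..t}" "\<lambda>s. y s * exp (- h s)"] by auto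
  have "y t * exp (- h t) = y 0 * exp (- h 0)"
    using k[of t] k[of 0] t by simp
  also have "\<dots> > 0" using y0 by simp
  finally show ?thesis by (simp add: zero_less_mult_iff)
qed

text \<open>Summation by parts moves the difference from \<open>flux\<close> to \<open>w\<close>,
  and each \<open>(w (n + 1) - w n) * flux n\<close> is charged to the energies at \<open>n\<close>
  and \<open>n + 1\<close>. The subtracted last term records that the outermost flux stays a
  boundary term and is not charged yet, which lets the induction step close.\<close>

lemma sum_by_parts_flux_bound:
  fixes w flux energy :: "int \<Rightarrow> real" and L :: nat
  assumes flux: "\<And>n. \<bar>flux n\<bar> \<le> energy n + energy (n + 1)" and energy: "\<And>n. 0 \<le> energy n"
  shows "(\<Sum>k\<le>L. w (a + int k) * (flux (a + int k - 1) - flux (a + int k)))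
    \<le> w a * flux (a - 1) - w (a + int L) * flux (a + int L)
      + (\<Sum>k\<le>L. energy (a + int k) * (\<bar>w (a + int k + 1) - w (a + int k)\<bar> + \<bar>w (a + int k - 1) - w (a + int k)\<bar>))
      - energy (a + int L) * \<bar>w (a + int L + 1) - w (a + int L)\<bar>"
proof (induction L)
  case 0
  show ?case using energy[of a] by (simp add: algebra_simps)
next
  case (Suc L)
  define n where "n = a + int L"
  have n: "a + int (Suc L) = n + 1" by (simp add: n_def)
  have "(w (n + 1) - w n) * flux n \<le> \<bar>w (n + 1) - w n\<bar> * \<bar>flux n\<bar>"
    by (metis abs_ge_self abs_mult)
  also have "\<dots> \<le> \<bar>w (n + 1) - w n\<bar> * (energy n + energy (n + 1))"
    by (rule mult_left_mono[OF flux]) simp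
  finally have "(w (n + 1) - w n) * flux n \<le> \<bar>w (n + 1) - w n\<bar> * (energy n + energy (n + 1))" .
  with Suc.IH show ?case
    unfolding sum.atMost_Suc n n_def[symmetric]
    by (simp add: algebra_simps abs_minus_commute)
qed

section \<open>Logistic weight and comparison of its differences with its derivative\<close>

definition logistic :: "real \<Rightarrow> real" where "logistic x = 1 / (1 + exp x)"

lemma logistic_bounds: "0 < logistic x" "logistic x < 1" "logistic x \<le> exp (- x)"
proof -
  have "1 + exp x > 0" by (simp add: add_pos_pos)
  then show "0 < logistic x" "logistic x < 1" unfolding logistic_def by (auto simp: divide_simps)
  have "1 / (1 + exp x) \<le> 1 / exp x"
    by (rule divide_left_mono) (auto simp: add_pos_pos)
  then show "logistic x \<le> exp (- x)" unfolding logistic_def by (simp add: exp_minus inverse_eq_divide)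
qed

lemma logistic_deriv: "(logistic has_real_derivative - (exp x / (1 + exp x)\<^sup>2)) (at x within S)"
proof -
  have "1 + exp x \<noteq> 0" by (metis add_pos_pos exp_gt_zero less_irrefl zero_less_one)
  then show ?thesis
    unfolding logistic_def[abs_def]
    by (auto intro!: derivative_eq_intros simp: power2_eq_square)
qed

text \<open>With \<open>u = exp x\<close> and \<open>s = exp (y - x)\<close> the difference is an
  explicit fraction, and the claim becomes
  \<open>|s - 1| * (1 + u) \<le> (exp d - 1) * (1 + u * s)\<close>. The factor
  \<open>exp d - 1\<close> is \<open>d\<close> to first order, so small steps lose almost nothing
  against the derivative; this allows front speeds arbitrarily close to 2.\<close>

lemma logistic_diff_le:
  assumes "\<bar>y - x\<bar> \<le> d"
  shows "\<bar>logistic y - logistic x\<bar> \<le> (exp d - 1) * (exp x / (1 + exp x)\<^sup>2)"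
proof -
  define u where "u = exp x"
  define s where "s = exp (y - x)"
  have u: "u > 0" and s: "s > 0" by (auto simp: u_def s_def)
  have pos: "1 + u > 0" "1 + u * s > 0" using u s by (auto simp: add_pos_pos)
  have y: "exp y = u * s" by (simp add: u_def s_def flip: exp_add)
  have sd: "s \<le> exp d" "1 / s \<le> exp d"
    using assms by (auto simp: s_def exp_diff[symmetric] divide_simps simp flip: exp_add)
  have eq: "logistic x - logistic y = u * (s - 1) / ((1 + u) * (1 + u * s))"
  proof -
    have "1 + u \<noteq> 0" "1 + u * s \<noteq> 0" using u s by (smt (verit) mult_pos_pos)+
    then show ?thesis unfolding logistic_def y u_def[symmetric] by (simp add: field_simps)
  qed
  have "\<bar>s - 1\<bar> * (1 + u) \<le> (exp d - 1) * (1 + u * s)"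
  proof (cases "s \<ge> 1")
    case True
    have "(s - 1) * (1 + u) \<le> (exp d - 1) * (1 + u * s)"
      using True sd u s order_trans[OF True sd(1)] by (intro mult_mono) auto
    then show ?thesis using True by simp
  next
    case False
    have "1 \<le> exp d * s" using sd(2) s by (simp add: field_simps)
    have "(1 - s) * (1 + u) \<le> (exp d - 1) * s * (1 + u)"
      using \<open>1 \<le> exp d * s\<close> u by (intro mult_right_mono) (auto simp: algebra_simps)
    also have "\<dots> = (exp d - 1) * (s + u * s)" by (simp add: algebra_simps)
    also have "\<dots> \<le> (exp d - 1) * (1 + u * s)"
    proof (rule mult_left_mono)
      show "s + u * s \<le> 1 + u * s" using False by simp
      show "0 \<le> exp d - 1" using assms by auto
    qed
    finally show ?thesis using False by simp
  qed
  then have "\<bar>s - 1\<bar> / (1 + u * s) \<le> (exp d - 1) / (1 + u)"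
    using pos by (simp add: divide_simps)
  then have "u / (1 + u) * (\<bar>s - 1\<bar> / (1 + u * s)) \<le> u / (1 + u) * ((exp d - 1) / (1 + u))"
    using u by (intro mult_left_mono) auto
  moreover have "\<bar>logistic y - logistic x\<bar> = u * \<bar>s - 1\<bar> / ((1 + u) * (1 + u * s))"
  proof -
    have "\<bar>logistic y - logistic x\<bar> = \<bar>u * (s - 1) / ((1 + u) * (1 + u * s))\<bar>"
      by (simp add: eq[symmetric] abs_minus_commute)
    then show ?thesis using u s by (simp add: abs_mult)
  qed
  ultimately show ?thesis unfolding u_def[symmetric] by (simp add: power2_eq_square mult.commute)
qed

text \<open>On integers of one sign the absolute value is injective, so each half is bounded by the
  series over the naturals. This makes initial data with quadratic decay absolutely
  summable.\<close>

lemma sum_int_inverse_square_bounded: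
  "\<exists>Z>0. \<forall>A::int set. finite A \<longrightarrow> (\<Sum>n\<in>A. 1 / (1 + \<bar>real_of_int n\<bar>)\<^sup>2) \<le> Z"
proof -
  define g where "g k = inverse ((real (Suc k))\<^sup>2)" for k
  define h where "h n = 1 / (1 + \<bar>real_of_int n\<bar>)\<^sup>2" for n
  have sg: "summable g"
    unfolding g_def using inverse_power_summable[of 2, where 'a=real]
    by (subst summable_Suc_iff[where f="\<lambda>k. inverse ((real k)\<^sup>2)"]) simp
  have half: "sum h A \<le> suminf g" if "finite A" "inj_on (\<lambda>n. nat \<bar>n\<bar>) A" for A
  proof -
    have "sum h A = sum g ((\<lambda>n. nat \<bar>n\<bar>) ` A)"
      using that by (simp add: sum.reindex h_def g_def inverse_eq_divide add.commute)
    also have "\<dots> \<le> suminf g"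
      by (rule sum_le_suminf[OF sg]) (use that in \<open>auto simp: g_def\<close>)
    finally show ?thesis .
  qed
  have "sum h A \<le> 2 * suminf g" if "finite A" for A
  proof -
    have "A = (A \<inter> {0..}) \<union> (A \<inter> {..<0})" by auto
    then have "sum h A = sum h (A \<inter> {0..}) + sum h (A \<inter> {..<0})"
      using that by (metis (no_types, lifting) finite_Int sum.union_disjoint inf_commute
          Int_emptyI IntD2 atLeast_iff lessThan_iff linorder_not_le)
    moreover have "sum h (A \<inter> {0..}) \<le> suminf g" "sum h (A \<inter> {..<0}) \<le> suminf g"
      by (intro half; use that in \<open>auto simp: inj_on_def\<close>)+
    ultimately show ?thesis by simp
  qed
  moreover have "suminf g > 0"
    by (rule suminf_pos[OF sg]) (simp add: g_def)
  ultimately show ?thesis unfolding h_def by (intro exI[of _ "2 * suminf g"]) auto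
qed

section \<open>The flow, its conserved density and the light cone\<close>

locale AL_flow =
  fixes R :: "int \<Rightarrow> real \<Rightarrow> complex" and K :: real
  assumes ode: "t \<ge> 0 \<Longrightarrow> (R n has_vector_derivative
              (\<i> * ((R (n + 1) t - 2 * R n t + R (n - 1) t)
                    - (cmod (R n t))\<^sup>2 * (R (n + 1) t + R (n - 1) t)))) (at t within {0..})"
    and small: "cmod (R n 0) < 1"
    and summ: "finite A \<Longrightarrow> (\<Sum>n\<in>A. cmod (R n 0)) \<le> K"
begin

definition flux :: "int \<Rightarrow> real \<Rightarrow> real" where
  "flux n t = 2 * Im (cnj (R n t) * R (n + 1) t)"

definition energy :: "int \<Rightarrow> real \<Rightarrow> real" where
  "energy n t = - ln (1 - (cmod (R n t))\<^sup>2)"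

text \<open>The term \<open>- 2 * R n t\<close> contributes an imaginary multiple of
  \<open>R n t\<close>, which is orthogonal to it, and the rest of the right-hand side carries the
  factor \<open>1 - |R|^2\<close>. Hence this quantity solves a linear equation, and its logarithm
  has a flux difference as derivative.\<close>

lemma deriv_one_minus_norm_sq:
  assumes "t \<ge> 0"
  shows "((\<lambda>t. 1 - (cmod (R n t))\<^sup>2) has_real_derivative
           (flux n t - flux (n - 1) t) * (1 - (cmod (R n t))\<^sup>2)) (at t within {0..})"
proof -
  define d where "d = \<i> * ((R (n + 1) t - 2 * R n t + R (n - 1) t)
                    - (cmod (R n t))\<^sup>2 * (R (n + 1) t + R (n - 1) t))"
  have "(R n has_derivative (\<lambda>h. h *\<^sub>R d)) (at t within {0..})"
    using ode[OF assms, of n] by (simp add: d_def has_vector_derivative_def)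
  from has_derivative_diff[OF has_derivative_const[of 1] has_derivative_inner[OF this this]]
  have "((\<lambda>t. 1 - R n t \<bullet> R n t) has_derivative (\<lambda>h. - (2 * (R n t \<bullet> d)) * h)) (at t within {0..})"
    by (rule has_derivative_eq_rhs) (auto simp: inner_commute)
  moreover have "- (2 * (R n t \<bullet> d)) = (flux n t - flux (n - 1) t) * (1 - (cmod (R n t))\<^sup>2)"
    unfolding flux_def d_def inner_complex_def cmod_power2
    by (simp add: algebra_simps power2_eq_square)
  ultimately show ?thesis
    by (simp add: has_field_derivative_def power2_norm_eq_inner)
qed

lemma continuous_on_R: "continuous_on {0..} (R n)"
  by (metis (no_types, lifting) ode atLeast_iff continuous_on_eq_continuous_within has_vector_derivative_continuous)

lemma norm_R_less_1:
  assumes "t \<ge> 0" shows "cmod (R n t) < 1"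
proof -
  have "1 - (cmod (R n t))\<^sup>2 > 0"
  proof (rule linear_ode_pos[where g = "\<lambda>t. flux n t - flux (n - 1) t", OF deriv_one_minus_norm_sq _ _ assms])
    show "continuous_on {0..} (\<lambda>t. flux n t - flux (n - 1) t)"
      unfolding flux_def by (intro continuous_intros continuous_on_R)
    show "0 < 1 - (cmod (R n 0))\<^sup>2" using small[of n] by (simp add: power_less_one_iff)
  qed auto
  then show ?thesis by (simp add: power_less_one_iff)
qed

lemma energy_deriv:
  assumes "t \<ge> 0"
  shows "(energy n has_real_derivative flux (n - 1) t - flux n t) (at t within {0..})"
proof -
  have "1 - (cmod (R n t))\<^sup>2 > 0" using norm_R_less_1[OF assms] by (simp add: power_less_one_iff)
  from DERIV_minus[OF DERIV_chain2[OF DERIV_ln_divide[OF this] deriv_one_minus_norm_sq[OF assms]]]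
  show ?thesis unfolding energy_def[abs_def]
    by (rule DERIV_cong) (use \<open>1 - (cmod (R n t))\<^sup>2 > 0\<close> in \<open>simp add: field_simps\<close>)
qed

lemma energy_ge:
  assumes "t \<ge> 0" shows "(cmod (R n t))\<^sup>2 \<le> energy n t"
proof -
  have "1 - (cmod (R n t))\<^sup>2 > 0" using norm_R_less_1[OF assms] by (simp add: power_less_one_iff)
  from ln_le_minus_one[OF this] show ?thesis by (simp add: energy_def)
qed

lemma flux_le:
  shows "\<bar>flux n t\<bar> \<le> (cmod (R n t))\<^sup>2 + (cmod (R (n + 1) t))\<^sup>2"
proof -
  have "\<bar>flux n t\<bar> \<le> 2 * (cmod (R n t) * cmod (R (n + 1) t))"
    unfolding flux_def using abs_Im_le_cmod[of "cnj (R n t) * R (n + 1) t"] by (simp add: norm_mult)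
  also have "\<dots> \<le> (cmod (R n t))\<^sup>2 + (cmod (R (n + 1) t))\<^sup>2"
    using sum_squares_bound[of "cmod (R n t)" "cmod (R (n + 1) t)"] by simp
  finally show ?thesis .
qed

text \<open>\<open>- ln (1 - x)\<close> is comparable to \<open>x\<close> only away from 1.
  Summability leaves finitely many sites with modulus at least 1/2, so all moduli are at most some
  \<open>M < 1\<close>.\<close>

lemma initial_energy_le: "\<exists>C>0. \<forall>n. energy n 0 \<le> C * (cmod (R n 0))\<^sup>2"
proof -
  define B where "B = {n. cmod (R n 0) \<ge> 1/2}"
  have "finite B"
  proof (rule ccontr)
    assume "infinite B"
    then obtain A where A: "A \<subseteq> B" "finite A" "card A = nat \<lceil>2 * K\<rceil> + 1"
      using infinite_arbitrarily_large by metis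
    have "(\<Sum>n\<in>A. 1/2) \<le> (\<Sum>n\<in>A. cmod (R n 0))"
      using A by (intro sum_mono) (auto simp: B_def)
    with summ[OF A(2)] have "real (card A) \<le> 2 * K" by simp
    then show False using A(3) by linarith
  qed
  \<comment> \<open>The inserted 1/2 covers the sites outside \<open>B\<close> and keeps the maximum
    meaningful when \<open>B\<close> is empty.\<close>
  define M where "M = Max (insert (1/2) ((\<lambda>n. cmod (R n 0)) ` B))"
  have M: "cmod (R n 0) \<le> M" for n
  proof (cases "n \<in> B")
    case True then show ?thesis unfolding M_def using \<open>finite B\<close> by (intro Max_ge) auto
  next
    case False
    then have "cmod (R n 0) \<le> 1/2" by (simp add: B_def)
    also have "\<dots> \<le> M" unfolding M_def using \<open>finite B\<close> by (intro Max_ge) auto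
    finally show ?thesis .
  qed
  have M1: "M < 1" unfolding M_def using \<open>finite B\<close> small by (subst Max_less_iff) auto
  have M0: "M \<ge> 0" using M[of 0] norm_ge_zero[of "R 0 0"] by linarith
  have d: "1 - M\<^sup>2 > 0" using M0 M1 by (simp add: power_less_one_iff)
  have "energy n 0 \<le> 1 / (1 - M\<^sup>2) * (cmod (R n 0))\<^sup>2" for n
  proof -
    define x where "x = (cmod (R n 0))\<^sup>2"
    have x: "0 \<le> x" "x \<le> M\<^sup>2" unfolding x_def using M by (auto intro: power_mono)
    have "- ln (1 - x) = ln (1 / (1 - x))" using x d by (simp add: ln_div)
    also have "\<dots> \<le> 1 / (1 - x) - 1" using x d by (intro ln_le_minus_one) auto
    also have "\<dots> = x / (1 - x)" using x d by (simp add: field_simps)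
    also have "\<dots> \<le> x / (1 - M\<^sup>2)" using x d by (intro divide_left_mono) auto
    finally show ?thesis by (simp add: energy_def x_def)
  qed
  then show ?thesis using d by (intro exI[of _ "1 / (1 - M\<^sup>2)"]) auto
qed

text \<open>The flux of the conserved density \<open>- ln (1 - |R|\<^sup>2)\<close> is at most the sum of the two adjacent
  densities, so energy moves at speed at most 2. The logistic weight centred at \<open>N\<close>, with a front
  closing in at speed \<open>v > 2\<close>, therefore decreases; the last term is the flux through the ends of the
  truncated sum, where only \<open>|R| < 1\<close> is available.\<close>
lemma weighted_energy:
  fixes M :: nat and N :: int and T v \<delta> :: real
  assumes \<delta>: "0 < \<delta>" "2 * (exp \<delta> - 1) \<le> v * \<delta>" and v: "v \<ge> 0" and T: "T \<ge> 0"
  shows "energy N T / 2 \<le> (\<Sum>n\<in>{N - int M..N + int M}. logistic (\<delta> * (real_of_int \<bar>n - N\<bar> - v * T)) * energy n 0)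
           + 4 * T * exp (- (\<delta> * (real M - v * T)))"
proof -
  \<comment> \<open>The front has radius \<open>v * (T - t)\<close> about \<open>N\<close>; at time
    \<open>T\<close> it has shrunk to \<open>N\<close> itself, where the weight is 1/2.\<close>
  define w where "w n t = logistic (\<delta> * (real_of_int \<bar>n - N\<bar> + v * (t - T)))" for n t
  define u where "u n t = exp (\<delta> * (real_of_int \<bar>n - N\<bar> + v * (t - T)))" for n t
  define dw where "dw n t = u n t / (1 + u n t)\<^sup>2" for n t
  define a where "a = N - int M"
  define S where "S t = (\<Sum>k\<le>2*M. w (a + int k) t * energy (a + int k) t)" for t
  define S' where "S' t = (\<Sum>k\<le>2*M. - (\<delta> * v * dw (a + int k) t) * energy (a + int k) t
      + w (a + int k) t * (flux (a + int k - 1) t - flux (a + int k) t))" for t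
  define \<epsilon> where "\<epsilon> = 4 * exp (- (\<delta> * (real M - v * T)))"
  have E0: "energy n t \<ge> 0" if "t \<ge> 0" for n t
    using energy_ge[OF that, of n] zero_le_power2[of "cmod (R n t)"] by linarith
  have dw0: "dw n t \<ge> 0" for n t by (simp add: dw_def u_def)
  have wd: "((\<lambda>t. w n t) has_real_derivative - (\<delta> * v * dw n t)) (at t within {0..T})" for n t
    unfolding w_def dw_def u_def
    by (rule DERIV_cong[OF DERIV_chain2[OF logistic_deriv]]) (auto intro!: derivative_eq_intros)
  have Sd: "(S has_real_derivative S' t) (at t within {0..T})" if "t \<in> {0..T}" for t
    unfolding S_def[abs_def] S'_def
  proof (rule DERIV_sum)
    fix k
    have "(energy (a + int k) has_real_derivative flux (a + int k - 1) t - flux (a + int k) t) (at t within {0..T})"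
      using energy_deriv[of t "a + int k"] that by (auto intro: DERIV_subset)
    from DERIV_mult[OF wd this]
    show "((\<lambda>t. w (a + int k) t * energy (a + int k) t) has_real_derivative
       - (\<delta> * v * dw (a + int k) t) * energy (a + int k) t
      + w (a + int k) t * (flux (a + int k - 1) t - flux (a + int k) t)) (at t within {0..T})"
      by (rule DERIV_cong) (simp add: algebra_simps)
  qed
  have S'le: "S' t \<le> \<epsilon>" if "t \<in> {0..T}" for t
  proof -
    have t: "t \<ge> 0" using that by auto
    \<comment> \<open>The bound by 2 serves at the two ends of the sum, the bound \<open>JE\<close>
      by neighbouring energies everywhere inside.\<close>
    have J2: "\<bar>flux n t\<bar> \<le> 2" for n
    proof -
      have "(cmod (R n t))\<^sup>2 \<le> 1" "(cmod (R (n+1) t))\<^sup>2 \<le> 1"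
        using norm_R_less_1[OF t] by (auto simp: power_le_one_iff less_imp_le)
      then show ?thesis using flux_le[of n t] by linarith
    qed
    have JE: "\<bar>flux n t\<bar> \<le> energy n t + energy (n + 1) t" for n
      using flux_le[of n t] energy_ge[OF t, of n] energy_ge[OF t, of "n + 1"] by linarith
    have near: "\<bar>w m t - w n t\<bar> \<le> (exp \<delta> - 1) * dw n t" if "\<bar>m - n\<bar> \<le> 1" for m n
      unfolding w_def dw_def u_def
    proof (rule logistic_diff_le)
      have "\<bar>real_of_int (abs (m - N)) - real_of_int (abs (n - N))\<bar> \<le> 1" using that by linarith
      then have "\<delta> * \<bar>real_of_int (abs (m - N)) - real_of_int (abs (n - N))\<bar> \<le> \<delta> * 1"
        using \<delta> by (intro mult_left_mono) auto
      moreover have "\<delta> * (real_of_int \<bar>m - N\<bar> + v * (t - T)) - \<delta> * (real_of_int \<bar>n - N\<bar> + v * (t - T))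
        = \<delta> * (real_of_int \<bar>m - N\<bar> - real_of_int \<bar>n - N\<bar>)" by (simp add: algebra_simps)
      ultimately show "\<bar>\<delta> * (real_of_int (abs (m - N)) + v * (t - T)) - \<delta> * (real_of_int (abs (n - N)) + v * (t - T))\<bar> \<le> \<delta>"
        using \<delta> by (simp add: abs_mult)
    qed
    \<comment> \<open>The two neighbour differences cost at most
      \<open>2 * (exp \<delta> - 1) * dw n t\<close>; the condition on \<open>v\<close> makes this
      no more than the decrease \<open>\<delta> * v * dw n t\<close> that the moving front
      produces.\<close>
    have loc: "energy n t * (\<bar>w (n + 1) t - w n t\<bar> + \<bar>w (n - 1) t - w n t\<bar>) \<le> \<delta> * v * dw n t * energy n t" for n
    proof -
      have "\<bar>w (n + 1) t - w n t\<bar> + \<bar>w (n - 1) t - w n t\<bar> \<le> 2 * (exp \<delta> - 1) * dw n t"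
        using near[of "n + 1" n] near[of "n - 1" n] by (simp add: algebra_simps)
      also have "\<dots> \<le> v * \<delta> * dw n t" using \<delta>(2) dw0 by (rule mult_right_mono)
      finally have "(\<bar>w (n + 1) t - w n t\<bar> + \<bar>w (n - 1) t - w n t\<bar>) * energy n t \<le> v * \<delta> * dw n t * energy n t"
        using E0[OF t] by (rule mult_right_mono)
      then show ?thesis by (simp only: mult_ac)
    qed
    have edge: "w n t \<le> exp (- (\<delta> * (real M - v * T)))" if "\<bar>n - N\<bar> = int M" for n
    proof -
      have "w n t \<le> exp (- (\<delta> * (real M + v * (t - T))))"
        unfolding w_def using logistic_bounds(3) that by (metis of_int_of_nat_eq)
      also have "\<dots> \<le> exp (- (\<delta> * (real M - v * T)))"
        using \<delta> v t by (simp add: algebra_simps)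
      finally show ?thesis .
    qed
    have e1: "w a t * flux (a - 1) t \<le> exp (- (\<delta> * (real M - v * T))) * 2"
    proof -
      have "w a t * flux (a - 1) t \<le> w a t * 2"
        using J2[of "a - 1"] logistic_bounds(1) by (intro mult_left_mono) (auto simp: w_def less_imp_le)
      also have "\<dots> \<le> exp (- (\<delta> * (real M - v * T))) * 2"
        using edge[of a] by (intro mult_right_mono) (auto simp: a_def)
      finally show ?thesis .
    qed
    have e2: "- (w (a + int (2*M)) t * flux (a + int (2*M)) t) \<le> exp (- (\<delta> * (real M - v * T))) * 2"
    proof -
      have "w (a + int (2*M)) t * (- flux (a + int (2*M)) t) \<le> w (a + int (2*M)) t * 2"
        using J2[of "a + int (2*M)"] logistic_bounds(1) by (intro mult_left_mono) (auto simp: w_def less_imp_le)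
      also have "\<dots> \<le> exp (- (\<delta> * (real M - v * T))) * 2"
        using edge[of "a + int (2*M)"] by (intro mult_right_mono) (auto simp: a_def)
      finally show ?thesis by simp
    qed
    have "(\<Sum>k\<le>2*M. w (a + int k) t * (flux (a + int k - 1) t - flux (a + int k) t))
      \<le> \<epsilon> + (\<Sum>k\<le>2*M. energy (a + int k) t * (\<bar>w (a + int k + 1) t - w (a + int k) t\<bar> + \<bar>w (a + int k - 1) t - w (a + int k) t\<bar>))"
      using sum_by_parts_flux_bound[of "\<lambda>n. flux n t" "\<lambda>n. energy n t" "\<lambda>n. w n t" a "2*M", OF JE E0[OF t]] e1 e2
        mult_nonneg_nonneg[OF E0[OF t, of "a + int (2*M)"] abs_ge_zero[of "w (a + int (2*M) + 1) t - w (a + int (2*M)) t"]]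
      unfolding \<epsilon>_def by linarith
    also have "\<dots> \<le> \<epsilon> + (\<Sum>k\<le>2*M. \<delta> * v * dw (a + int k) t * energy (a + int k) t)"
      by (intro add_left_mono sum_mono loc)
    finally show ?thesis unfolding S'_def sum.distrib by (simp add: sum_negf)
  qed
  obtain \<xi> where "\<xi> \<in> {0..T}" "S T - S 0 = S' \<xi> * (T - 0)"
    using mvt_very_simple[of 0 T S "\<lambda>t h. S' t * h"] Sd T
    by (auto simp: has_field_derivative_def)
  then have "S T \<le> S 0 + \<epsilon> * T"
    using S'le[of \<xi>] T mult_right_mono[of "S' \<xi>" \<epsilon> T] by auto
  moreover have "energy N T / 2 \<le> S T"
  proof -
    have "w N T = 1/2" by (simp add: w_def logistic_def)
    then have "energy N T / 2 = w (a + int M) T * energy (a + int M) T" by (simp add: a_def)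
    also have "\<dots> \<le> S T" unfolding S_def
      by (rule member_le_sum[where f="\<lambda>k. w (a + int k) T * energy (a + int k) T"])
         (use E0[OF T] logistic_bounds(1) in \<open>auto simp: w_def less_imp_le intro!: mult_nonneg_nonneg\<close>)
    finally show ?thesis .
  qed
  moreover have "S 0 = (\<Sum>n\<in>{N - int M..N + int M}. logistic (\<delta> * (real_of_int \<bar>n - N\<bar> - v * T)) * energy n 0)"
    unfolding S_def w_def
  proof (rule sum.reindex_bij_witness[where i="\<lambda>n. nat (n - a)" and j="\<lambda>k. a + int k"])
  qed (auto simp: a_def)
  ultimately show ?thesis by (simp add: \<epsilon>_def algebra_simps)
qed

text \<open>In the region \<open>v * t\<close> is at most a fixed fraction of \<open>N\<close>, so
  sites below \<open>\<eta> * N\<close> lie at least \<open>\<eta> * N\<close> outside the initial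
  front and carry exponentially small weight. At the other sites one factor of \<open>|R|^2\<close>
  is bounded by \<open>g\<close> and the other is summed, which costs \<open>K\<close>.\<close>

lemma light_cone_bound:
  fixes V :: real
  assumes V: "V > 0"
  shows "\<exists>C>0. \<exists>\<eta>>0. \<exists>\<kappa>>0. \<forall>N t g. 0 \<le> t \<longrightarrow> real_of_int N > (2 + V) * t \<longrightarrow> g \<ge> 0 \<longrightarrow>
     (\<forall>k. real_of_int k \<ge> \<eta> * real_of_int N \<longrightarrow> cmod (R k 0) \<le> g) \<longrightarrow>
     (cmod (R N t))\<^sup>2 \<le> C * (g + exp (- (\<kappa> * real_of_int N)))"
proof -
  \<comment> \<open>\<open>v\<close> is the midpoint of 2 and \<open>2 + V\<close>,
    \<open>\<theta>\<close> bounds the fraction of \<open>N\<close> that \<open>v * t\<close> can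
    reach, and \<open>\<eta>\<close> is half of the remaining slack. The choice
    \<open>\<delta> \<le> V / 4\<close> yields the speed condition through
    \<open>exp \<delta> \<le> 1 + \<delta> + \<delta>^2\<close>.\<close>
  define v where "v = 2 + V / 2"
  define \<delta> where "\<delta> = min 1 (V / 4)"
  define \<theta> where "\<theta> = v / (2 + V)"
  define \<eta> where "\<eta> = (1 - \<theta>) / 2"
  have \<delta>: "0 < \<delta>" "\<delta> \<le> 1" "\<delta> \<le> V / 4" using V by (auto simp: \<delta>_def)
  have \<eta>: "\<eta> > 0" using V by (simp add: \<eta>_def \<theta>_def v_def)
  have ex: "2 * (exp \<delta> - 1) \<le> v * \<delta>"
  proof -
    have "exp \<delta> \<le> 1 + \<delta> + \<delta>\<^sup>2" using exp_bound[of \<delta>] \<delta> by simp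
    moreover have "\<delta> * \<delta> \<le> \<delta> * (V / 4)" using \<delta> by (intro mult_left_mono) auto
    ultimately show ?thesis by (simp add: v_def algebra_simps power2_eq_square)
  qed
  obtain C where C: "C > 0" "\<And>n. energy n 0 \<le> C * (cmod (R n 0))\<^sup>2" using initial_energy_le by blast
  have K: "K \<ge> 0" using summ[of "{}"] by simp
  have main: "(cmod (R N t))\<^sup>2 \<le> 2 * C * (K + 1) * (g + exp (- (\<delta> * \<eta> * real_of_int N)))"
    if t: "0 \<le> t" and N: "real_of_int N > (2 + V) * t" and g: "g \<ge> 0"
      and tail: "\<And>k. real_of_int k \<ge> \<eta> * real_of_int N \<Longrightarrow> cmod (R k 0) \<le> g" for N t g
  proof -
    define e where "e = exp (- (\<delta> * \<eta> * real_of_int N))"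
    have vt: "v * t \<le> (1 - 2 * \<eta>) * real_of_int N"
    proof -
      have "v * t = \<theta> * ((2 + V) * t)" using V by (simp add: \<theta>_def)
      also have "\<dots> \<le> \<theta> * real_of_int N"
        using N V by (intro mult_left_mono) (auto simp: \<theta>_def v_def)
      also have "\<theta> = 1 - 2 * \<eta>" by (simp add: \<eta>_def field_simps)
      finally show ?thesis .
    qed
    have summand: "logistic (\<delta> * (real_of_int \<bar>n - N\<bar> - v * t)) * energy n 0 \<le> C * (g + e) * cmod (R n 0)" for n
    proof (cases "real_of_int n \<ge> \<eta> * real_of_int N")
      case True
      have "0 \<le> energy n 0" using energy_ge[of 0 n] by (meson order_refl order_trans zero_le_power2)
      then have "logistic (\<delta> * (real_of_int \<bar>n - N\<bar> - v * t)) * energy n 0 \<le> 1 * (C * (cmod (R n 0) * cmod (R n 0)))"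
        using C(2)[of n] logistic_bounds energy_ge[of 0 n] C(1)
        by (intro mult_mono) (auto simp: less_imp_le power2_eq_square)
      also have "\<dots> \<le> 1 * (C * ((g + e) * cmod (R n 0)))"
        using tail[OF True] C(1)
        by (intro mult_left_mono mult_right_mono) (auto simp: e_def intro: add_increasing2)
      finally show ?thesis by (simp add: mult_ac)
    next
      case False
      have "\<eta> * real_of_int N \<le> real_of_int \<bar>n - N\<bar> - v * t"
        using vt False by (simp add: algebra_simps)
      then have "\<delta> * (\<eta> * real_of_int N) \<le> \<delta> * (real_of_int \<bar>n - N\<bar> - v * t)"
        using \<delta> by (intro mult_left_mono) auto
      then have "logistic (\<delta> * (real_of_int \<bar>n - N\<bar> - v * t)) \<le> e"
        using logistic_bounds(3)[of "\<delta> * (real_of_int \<bar>n - N\<bar> - v * t)"]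
        unfolding e_def by (smt (verit) exp_le_cancel_iff mult.assoc)
      moreover have "(cmod (R n 0))\<^sup>2 \<le> cmod (R n 0)"
        using small[of n] by (simp add: power2_eq_square mult_left_le less_imp_le)
      then have "energy n 0 \<le> C * cmod (R n 0)"
        using C(2)[of n] C(1) by (meson mult_left_mono less_imp_le order_trans)
      moreover have "0 \<le> energy n 0" using energy_ge[of 0 n] by (meson order_refl order_trans zero_le_power2)
      ultimately have "logistic (\<delta> * (real_of_int \<bar>n - N\<bar> - v * t)) * energy n 0 \<le> (g + e) * (C * cmod (R n 0))"
        using g by (intro mult_mono) (auto simp: e_def)
      then show ?thesis by (simp add: mult_ac)
    qed
    have bound: "(\<Sum>n\<in>{N - int M..N + int M}. logistic (\<delta> * (real_of_int \<bar>n - N\<bar> - v * t)) * energy n 0)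
        \<le> C * (g + e) * K" for M
    proof -
      have "(\<Sum>n\<in>{N - int M..N + int M}. logistic (\<delta> * (real_of_int \<bar>n - N\<bar> - v * t)) * energy n 0)
        \<le> (\<Sum>n\<in>{N - int M..N + int M}. C * (g + e) * cmod (R n 0))"
        by (intro sum_mono summand)
      also have "\<dots> \<le> C * (g + e) * K"
        unfolding sum_distrib_left[symmetric] using C(1) g
        by (intro mult_left_mono summ) (auto simp: e_def add_nonneg_nonneg)
      finally show ?thesis .
    qed
    have "energy N t / 2 \<le> C * (g + e) * K + 4 * t * exp (- (\<delta> * (real M - v * t)))" for M
      using weighted_energy[OF \<delta>(1) ex _ t, of N M] bound[of M] V by (simp add: v_def)
    \<comment> \<open>Letting \<open>M\<close> grow removes the flux through the ends of the
      truncated sum.\<close>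
    moreover have "(\<lambda>M. C * (g + e) * K + 4 * t * exp (- (\<delta> * (real M - v * t)))) \<longlonglongrightarrow> C * (g + e) * K + 4 * t * 0"
      using \<delta>(1) by (intro tendsto_intros) real_asymp
    ultimately have "energy N t / 2 \<le> C * (g + e) * K + 4 * t * 0"
      by (intro LIMSEQ_le_const) auto
    then have "energy N t \<le> 2 * C * K * (g + e)" by (simp add: algebra_simps)
    \<comment> \<open>\<open>K + 1\<close> keeps the constant positive when \<open>K\<close> is
      0.\<close>
    also have "\<dots> \<le> 2 * C * (K + 1) * (g + e)"
      using C(1) g by (intro mult_right_mono) (auto simp: e_def)
    finally show ?thesis using energy_ge[OF t, of N] unfolding e_def by linarith
  qed
  show ?thesis
  proof (intro exI conjI allI impI)
    show "2 * C * (K + 1) > 0" using C K by simp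
    show "\<eta> > 0" by fact
    show "\<delta> * \<eta> > 0" using \<delta> \<eta> by simp
  qed (use main in blast)
qed

text \<open>Each product is the exponential of minus the energy on \<open>A\<close>, and that energy
  is at most \<open>C * K\<close>. The uniform lower bound later keeps the Jost determinants away
  from 0.\<close>

lemma initial_prod_ge: "\<exists>d>0. \<forall>A. finite A \<longrightarrow> d \<le> (\<Prod>n\<in>A. 1 - (cmod (R n 0))\<^sup>2)"
proof -
  obtain C where C: "C > 0" "\<And>n. energy n 0 \<le> C * (cmod (R n 0))\<^sup>2" using initial_energy_le by blast
  have "exp (- (C * K)) \<le> (\<Prod>n\<in>A. 1 - (cmod (R n 0))\<^sup>2)" if A: "finite A" for A
  proof -
    have sq: "(cmod (R n 0))\<^sup>2 \<le> cmod (R n 0)" for n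
      using small[of n] by (simp add: power2_eq_square mult_left_le less_imp_le)
    have "energy n 0 \<le> C * cmod (R n 0)" for n
      using C(2)[of n] mult_left_mono[OF sq[of n], of C] C(1) by linarith
    then have "(\<Sum>n\<in>A. energy n 0) \<le> (\<Sum>n\<in>A. C * cmod (R n 0))" by (intro sum_mono)
    also have "\<dots> \<le> C * K"
      unfolding sum_distrib_left[symmetric] using C(1) by (intro mult_left_mono summ A) auto
    finally have "exp (- (C * K)) \<le> exp (\<Sum>n\<in>A. - energy n 0)" by (simp add: sum_negf)
    also have "\<dots> = (\<Prod>n\<in>A. exp (- energy n 0))" using A by (rule exp_sum)
    also have "\<dots> = (\<Prod>n\<in>A. 1 - (cmod (R n 0))\<^sup>2)"
      using small by (intro prod.cong) (auto simp: energy_def power_less_one_iff)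
    finally show ?thesis .
  qed
  then show ?thesis by (intro exI[of _ "exp (- (C * K))"]) auto
qed

end

section \<open>Means over the unit circle\<close>

text \<open>The contour integral of \<open>f w / w\<close> over the unit circle, divided by 2\<pi>i.
  As an integral over a real parameter it commutes with conjugation.\<close>

definition circ_mean :: "(complex \<Rightarrow> complex) \<Rightarrow> complex" where
  "circ_mean f = integral {0..1} (\<lambda>x. f (circlepath 0 1 x))"

lemma circlepath01_sphere: "circlepath 0 1 x \<in> sphere 0 1"
  by (simp add: circlepath)

lemma circ_integrable:
  fixes f :: "complex \<Rightarrow> complex"
  assumes "continuous_on (sphere 0 1) f"
  shows "(\<lambda>x. f (circlepath 0 1 x)) integrable_on {0..1}"
proof (rule integrable_continuous_real)
  show "continuous_on {0..1} (\<lambda>x. f (circlepath 0 1 x))"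
    by (rule continuous_on_compose2[OF assms])
       (auto simp: circlepath intro!: continuous_intros)
qed

lemma circ_mean_cong:
  assumes "\<And>w. w \<in> sphere 0 1 \<Longrightarrow> f w = g w"
  shows "circ_mean f = circ_mean g"
  unfolding circ_mean_def by (rule integral_cong) (use assms circlepath01_sphere in blast)

lemma circ_mean_diff:
  assumes "continuous_on (sphere 0 1) f" "continuous_on (sphere 0 1) g"
  shows "circ_mean (\<lambda>w. f w - g w) = circ_mean f - circ_mean g"
  unfolding circ_mean_def using assms by (intro integral_diff circ_integrable)

lemma circ_mean_cnj: "circ_mean (\<lambda>w. cnj (f w)) = cnj (circ_mean f)"
  unfolding circ_mean_def by (simp add: integral_cnj)

lemma circ_mean_norm_le:
  assumes "continuous_on (sphere 0 1) f" "\<And>w. w \<in> sphere 0 1 \<Longrightarrow> cmod (f w) \<le> B"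
  shows "cmod (circ_mean f) \<le> B"
proof -
  have "cmod (circ_mean f) \<le> integral {0..1} (\<lambda>x::real. B)"
    unfolding circ_mean_def
    by (rule integral_norm_bound_integral)
       (use assms circ_integrable circlepath01_sphere in auto)
  then show ?thesis by simp
qed

lemma contour_integral_circlepath_mean:
  assumes "\<rho> > 0"
  shows "contour_integral (circlepath 0 \<rho>) (\<lambda>w. h w / w) = 2 * of_real pi * \<i> * circ_mean (\<lambda>w. h (\<rho> * w))"
proof -
  have "contour_integral (circlepath 0 \<rho>) (\<lambda>w. h w / w)
      = integral {0..1} (\<lambda>x. 2 * of_real pi * \<i> * h (\<rho> * circlepath 0 1 x))"
    unfolding contour_integral_integral vector_derivative_circlepath
    using assms by (intro integral_cong) (simp add: circlepath)
  then show ?thesis by (simp add: circ_mean_def)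
qed

lemma circ_mean_holomorphic:
  assumes "continuous_on (cball 0 1) h" "h holomorphic_on ball 0 1"
  shows "circ_mean h = h 0"
proof -
  have "contour_integral (circlepath 0 1) (\<lambda>w. h w / w) = 2 * of_real pi * \<i> * h 0"
    using Cauchy_integral_circlepath[OF assms, of 0] by (simp add: contour_integral_unique)
  then show ?thesis using contour_integral_circlepath_mean[of 1 h] by simp
qed

text \<open>Radial segments join the unit circle to the circle of radius \<open>\<rho>\<close>
  inside \<open>S\<close> without meeting 0, so the integral of \<open>h w / w\<close> does not
  change. On the smaller circle high powers of \<open>w\<close> are small, which is how exponential
  decay arises.\<close>

lemma circ_mean_shift:
  assumes S: "open S" "h holomorphic_on S" "0 < \<rho>" "\<rho> \<le> 1"
    and ann: "\<And>w. \<rho> \<le> cmod w \<Longrightarrow> cmod w \<le> 1 \<Longrightarrow> w \<in> S"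
  shows "circ_mean h = circ_mean (\<lambda>w. h (\<rho> * w))"
proof -
  have "contour_integral (circlepath 0 1) (\<lambda>w. h w / w) = contour_integral (circlepath 0 \<rho>) (\<lambda>w. h w / w)"
  proof (rule Cauchy_theorem_homotopic_loops[where S = "S - {0}"])
    show "open (S - {0})" using S by auto
    show "(\<lambda>w. h w / w) holomorphic_on S - {0}"
      using S by (auto intro!: holomorphic_intros intro: holomorphic_on_subset)
    show "homotopic_loops (S - {0}) (circlepath 0 1) (circlepath 0 \<rho>)"
    proof (rule homotopic_loops_linear)
      fix t :: real
      show "closed_segment (circlepath 0 1 t) (circlepath 0 \<rho> t) \<subseteq> S - {0}"
      proof
        fix x assume "x \<in> closed_segment (circlepath 0 1 t) (circlepath 0 \<rho> t)"
        then obtain u where u: "0 \<le> u" "u \<le> 1"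
          "x = (1 - u) *\<^sub>R circlepath 0 1 t + u *\<^sub>R circlepath 0 \<rho> t"
          by (auto simp: closed_segment_def)
        have "x = complex_of_real (1 - u + u * \<rho>) * exp (2 * of_real pi * \<i> * of_real t)"
          unfolding u(3) by (simp add: circlepath scaleR_conv_of_real algebra_simps)
        then have "cmod x = \<bar>1 - u + u * \<rho>\<bar>" by (simp add: norm_mult del: of_real_add of_real_diff of_real_mult)
        moreover have "1 - u + u * \<rho> \<ge> \<rho>" "1 - u + u * \<rho> \<le> 1"
          using u(1,2) S(3,4) mult_left_le[of "\<rho>" u] mult_left_mono[of \<rho> 1 "1 - u"]
          by (auto simp: algebra_simps)
        ultimately show "x \<in> S - {0}" using ann[of x] S(3) by auto
      qed
    qed auto
  qed auto
  then show ?thesis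
    using contour_integral_circlepath_mean[of 1 h] contour_integral_circlepath_mean[of \<rho> h] S(3) by simp
qed

section \<open>Jost solutions\<close>

text \<open>One step of the spectral problem in the variable \<open>w = 1 / z\<close> for Jost solutions stripped of their
  exponential factor, without the normalising determinant \<open>1 - |R|\<^sup>2\<close>. The same map serves both ends:
  \<open>c = - cnj (R n)\<close> steps \<open>\<psi>\<close> from \<open>n + 1\<close> down to \<open>n\<close>, and \<open>c = R n\<close> steps the swapped components
  of \<open>\<phi>\<close> from \<open>n\<close> up to \<open>n + 1\<close>.\<close>
definition AL_step :: "complex \<Rightarrow> complex \<Rightarrow> complex \<times> complex \<Rightarrow> complex \<times> complex" where
  "AL_step c w x = (w\<^sup>2 * fst x + w * c * snd x, snd x + w * cnj c * fst x)"

text \<open>The last coefficient acts first: a vector prescribed at site \<open>N\<close> is carried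
  back to site 0.\<close>

fun AL_prop :: "(nat \<Rightarrow> complex) \<Rightarrow> nat \<Rightarrow> complex \<Rightarrow> complex \<times> complex \<Rightarrow> complex \<times> complex" where
  "AL_prop c 0 w x = x"
| "AL_prop c (Suc N) w x = AL_prop c N w (AL_step (c N) w x)"

definition pair_norm :: "complex \<times> complex \<Rightarrow> real" where "pair_norm x = cmod (fst x) + cmod (snd x)"
text \<open>An indefinite form of signature (1,1). A step multiplies it by \<open>1 - |c|^2\<close>
  on the unit circle, and by at least this in the sense of \<open>AL_step_hyp_ge\<close> inside, so
  a second component that dominates keeps dominating.\<close>

definition pair_hyp :: "complex \<times> complex \<Rightarrow> real" where "pair_hyp x = (cmod (snd x))\<^sup>2 - (cmod (fst x))\<^sup>2"

lemma AL_step_diff: "AL_step c w (x - y) = AL_step c w x - AL_step c w y"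
  by (simp add: AL_step_def algebra_simps)

lemma AL_step_scale: "AL_step c w (s *\<^sub>R x) = s *\<^sub>R AL_step c w x"
  by (simp add: AL_step_def algebra_simps)

lemma AL_prop_diff: "AL_prop c N w (x - y) = AL_prop c N w x - AL_prop c N w y"
  by (induction N arbitrary: x y) (auto simp: AL_step_diff)

lemma AL_prop_scale: "AL_prop c N w (s *\<^sub>R x) = s *\<^sub>R AL_prop c N w x"
  by (induction N arbitrary: x) (auto simp: AL_step_scale)

lemma AL_prop_Suc_left: "AL_prop c (Suc N) w x = AL_step (c 0) w (AL_prop (\<lambda>k. c (Suc k)) N w x)"
proof (induction N arbitrary: x)
  case (Suc N)
  show ?case using Suc.IH[of "AL_step (c (Suc N)) w x"] by simp
qed simp

lemma AL_step_norm:
  assumes "cmod w \<le> 1" shows "pair_norm (AL_step c w x) \<le> (1 + cmod c) * pair_norm x"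
proof -
  have w: "cmod w * a \<le> a" if "a \<ge> 0" for a using assms that by (simp add: mult_left_le_one_le)
  have "cmod (w\<^sup>2 * fst x + w * c * snd x) \<le> cmod (w\<^sup>2) * cmod (fst x) + cmod w * (cmod c * cmod (snd x))"
    by (metis (no_types, lifting) mult.assoc norm_mult norm_triangle_ineq)
  also have "\<dots> \<le> cmod (fst x) + cmod c * cmod (snd x)"
    using assms by (intro add_mono w) (auto simp: norm_power power_le_one intro!: mult_left_le_one_le)
  finally have 1: "cmod (w\<^sup>2 * fst x + w * c * snd x) \<le> cmod (fst x) + cmod c * cmod (snd x)" .
  have "cmod (snd x + w * cnj c * fst x) \<le> cmod (snd x) + cmod w * (cmod c * cmod (fst x))"
    by (metis (no_types, lifting) complex_mod_cnj mult.assoc norm_mult norm_triangle_ineq)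
  also have "\<dots> \<le> cmod (snd x) + cmod c * cmod (fst x)"
    by (intro add_left_mono w) auto
  finally show ?thesis using 1 by (simp add: AL_step_def pair_norm_def algebra_simps)
qed

lemma AL_prop_norm:
  assumes "cmod w \<le> 1" shows "pair_norm (AL_prop c N w x) \<le> (\<Prod>k<N. 1 + cmod (c k)) * pair_norm x"
proof (induction N arbitrary: x)
  case (Suc N)
  have "pair_norm (AL_prop c (Suc N) w x) \<le> (\<Prod>k<N. 1 + cmod (c k)) * pair_norm (AL_step (c N) w x)"
    using Suc.IH by simp
  also have "\<dots> \<le> (\<Prod>k<N. 1 + cmod (c k)) * ((1 + cmod (c N)) * pair_norm x)"
    by (intro mult_left_mono AL_step_norm assms prod_nonneg) auto
  finally show ?case by (simp add: mult_ac)
qed simp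

text \<open>Pulling one \<open>w\<close> out of the first component leaves the matrix with rows
  \<open>(1, c)\<close> and \<open>(cnj c, 1)\<close>, which multiplies the form by
  \<open>1 - |c|^2\<close>. The last term comes from the extracted \<open>w\<close> and is
  nonnegative in the closed disc.\<close>

lemma AL_step_hyp_eq: "pair_hyp (AL_step c w x) =
   (1 - (cmod c)\<^sup>2) * ((cmod (snd x))\<^sup>2 - (cmod (w * fst x))\<^sup>2)
   + (1 - (cmod w)\<^sup>2) * (cmod (w * fst x + c * snd x))\<^sup>2"
proof -
  define a where "a = w * fst x"
  define b where "b = snd x"
  have 1: "AL_step c w x = (w * (a + c * b), b + cnj c * a)"
    by (simp add: AL_step_def a_def b_def algebra_simps power2_eq_square)
  have "(cmod (b + cnj c * a))\<^sup>2 - (cmod (a + c * b))\<^sup>2 = (1 - (cmod c)\<^sup>2) * ((cmod b)\<^sup>2 - (cmod a)\<^sup>2)"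
    unfolding cmod_power2 by (simp add: power2_eq_square algebra_simps)
  then show ?thesis
    unfolding 1 pair_hyp_def fst_conv snd_conv norm_mult[of w "a + c * b"] power_mult_distrib
    by (fold a_def b_def) (simp add: algebra_simps)
qed

lemma AL_step_hyp_circle: "cmod w = 1 \<Longrightarrow> pair_hyp (AL_step c w x) = (1 - (cmod c)\<^sup>2) * pair_hyp x"
  unfolding AL_step_hyp_eq by (simp add: norm_mult pair_hyp_def)

lemma AL_step_hyp_ge:
  assumes "cmod w \<le> 1" "cmod c < 1"
  shows "pair_hyp (AL_step c w x) \<ge> (1 - (cmod c)\<^sup>2) * pair_hyp x"
proof -
  have c: "(cmod c)\<^sup>2 \<le> 1" and w: "(cmod w)\<^sup>2 \<le> 1" using assms by (auto simp: power_le_one)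
  have "(cmod (w * fst x))\<^sup>2 \<le> (cmod (fst x))\<^sup>2"
    using assms by (intro power_mono) (auto simp: norm_mult mult_left_le_one_le)
  then have "(1 - (cmod c)\<^sup>2) * pair_hyp x \<le> (1 - (cmod c)\<^sup>2) * ((cmod (snd x))\<^sup>2 - (cmod (w * fst x))\<^sup>2)"
    using c unfolding pair_hyp_def by (intro mult_left_mono) auto
  moreover have "(1 - (cmod w)\<^sup>2) * (cmod (w * fst x + c * snd x))\<^sup>2 \<ge> 0" using w by simp
  ultimately show ?thesis unfolding AL_step_hyp_eq by linarith
qed

lemma AL_prop_hyp_circle:
  assumes "cmod w = 1" shows "pair_hyp (AL_prop c N w x) = (\<Prod>k<N. 1 - (cmod (c k))\<^sup>2) * pair_hyp x"
  by (induction N arbitrary: x) (auto simp: AL_step_hyp_circle[OF assms] mult_ac)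

lemma AL_prop_hyp_ge:
  assumes "cmod w \<le> 1" "\<And>k. cmod (c k) < 1"
  shows "pair_hyp (AL_prop c N w x) \<ge> (\<Prod>k<N. 1 - (cmod (c k))\<^sup>2) * pair_hyp x"
proof (induction N arbitrary: x)
  case (Suc N)
  have "(\<Prod>k<N. 1 - (cmod (c k))\<^sup>2) * ((1 - (cmod (c N))\<^sup>2) * pair_hyp x) \<le> (\<Prod>k<N. 1 - (cmod (c k))\<^sup>2) * pair_hyp (AL_step (c N) w x)"
    using assms by (intro mult_left_mono AL_step_hyp_ge prod_nonneg) (auto simp: power_le_one less_imp_le)
  also have "\<dots> \<le> pair_hyp (AL_prop c (Suc N) w x)" using Suc.IH by simp
  finally show ?case by (simp add: mult_ac)
qed simp

lemma AL_prop_holomorphic: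
  assumes "(\<lambda>w. fst (x w)) holomorphic_on S" "(\<lambda>w. snd (x w)) holomorphic_on S"
  shows "(\<lambda>w. fst (AL_prop c N w (x w))) holomorphic_on S \<and> (\<lambda>w. snd (AL_prop c N w (x w))) holomorphic_on S"
  using assms
proof (induction N arbitrary: x)
  case (Suc N)
  have "(\<lambda>w. fst (AL_step (c N) w (x w))) holomorphic_on S" "(\<lambda>w. snd (AL_step (c N) w (x w))) holomorphic_on S"
    unfolding AL_step_def fst_conv snd_conv using Suc.prems by (auto intro!: holomorphic_intros)
  from Suc.IH[OF this] show ?case by simp
qed auto

lemma snd_AL_prop_0: "snd (AL_prop c N 0 x) = snd x"
  by (induction N arbitrary: x) (auto simp: AL_step_def)

section \<open>Jost functions: the asymptotic value \<open>(0, 1)\<close> transported from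
  infinity\<close>

definition jost_fst :: "(nat \<Rightarrow> complex) \<Rightarrow> complex \<Rightarrow> complex" where
  "jost_fst c w = lim (\<lambda>N. fst (AL_prop c N w (0, 1)))"
definition jost_snd :: "(nat \<Rightarrow> complex) \<Rightarrow> complex \<Rightarrow> complex" where
  "jost_snd c w = lim (\<lambda>N. snd (AL_prop c N w (0, 1)))"

lemma prod_1_plus_le:
  fixes c :: "nat \<Rightarrow> complex"
  assumes "\<And>N. (\<Sum>k<N. cmod (c k)) \<le> K"
  shows "(\<Prod>k<N. 1 + cmod (c k)) \<le> exp K"
proof -
  have "(\<Prod>k<N. 1 + cmod (c k)) \<le> (\<Prod>k<N. exp (cmod (c k)))"
    by (intro prod_mono) (auto simp: add_nonneg_nonneg)
  also have "\<dots> = exp (\<Sum>k<N. cmod (c k))" by (rule exp_sum[symmetric]) simp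
  finally show ?thesis using assms[of N] by (smt (verit) exp_le_cancel_iff)
qed

lemma AL_prop_norm_bound:
  assumes "\<And>N. (\<Sum>k<N. cmod (c k)) \<le> K" "cmod w \<le> 1"
  shows "pair_norm (AL_prop c N w x) \<le> exp K * pair_norm x"
proof -
  have "pair_norm (AL_prop c N w x) \<le> (\<Prod>k<N. 1 + cmod (c k)) * pair_norm x" by (rule AL_prop_norm[OF assms(2)])
  also have "\<dots> \<le> exp K * pair_norm x"
    using prod_1_plus_le[OF assms(1)] by (intro mult_right_mono) (auto simp: pair_norm_def)
  finally show ?thesis .
qed

lemma norm_fst_le_pair_norm: "cmod (fst x) \<le> pair_norm x" and norm_snd_le_pair_norm: "cmod (snd x) \<le> pair_norm x"
  by (auto simp: pair_norm_def)

text \<open>The M-test applied to the telescoping series of increments; the limit is written with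
  \<open>lim\<close> to match \<open>jost_fst\<close> and \<open>jost_snd\<close>.\<close>

lemma uniform_limit_telescope:
  fixes f :: "nat \<Rightarrow> complex \<Rightarrow> complex"
  assumes b: "\<And>n x. x \<in> A \<Longrightarrow> cmod (f (Suc n) x - f n x) \<le> M n" and M: "summable M"
  shows "uniform_limit A f (\<lambda>x. lim (\<lambda>n. f n x)) sequentially"
proof -
  define g where "g x = suminf (\<lambda>i. f (Suc i) x - f i x) + f 0 x" for x
  have "uniform_limit A (\<lambda>n x. (\<Sum>i<n. f (Suc i) x - f i x) + f 0 x) g sequentially"
    unfolding g_def by (intro uniform_limit_intros Weierstrass_m_test[OF b M])
  moreover have "(\<lambda>n x. (\<Sum>i<n. f (Suc i) x - f i x) + f 0 x) = f"
    by (intro ext) (simp add: sum_lessThan_telescope[where f="\<lambda>i. f i _"])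
  ultimately have u: "uniform_limit A f g sequentially" by simp
  moreover have "g x = lim (\<lambda>n. f n x)" if "x \<in> A" for x
    using tendsto_uniform_limitI[OF u that] by (simp add: limI)
  ultimately show ?thesis by (simp cong: uniform_limit_cong')
qed

text \<open>Raising \<open>N\<close> by one changes the starting vector by
  \<open>AL_step (c N) w (0, 1) - (0, 1) = (w * c N, 0)\<close>. Transport costs at most the factor
  \<open>exp K\<close>, so the increments are dominated by the summable
  \<open>exp K * cmod (c N)\<close>.\<close>

lemma jost_uniform:
  assumes K: "\<And>N. (\<Sum>k<N. cmod (c k)) \<le> K"
  shows "uniform_limit (cball 0 1) (\<lambda>N w. fst (AL_prop c N w (0, 1))) (jost_fst c) sequentially"
    and "uniform_limit (cball 0 1) (\<lambda>N w. snd (AL_prop c N w (0, 1))) (jost_snd c) sequentially"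
proof -
  have sm: "summable (\<lambda>N. exp K * cmod (c N))"
    by (intro summable_mult) (rule bounded_imp_summable[where B=K], use K[of "Suc _"] in \<open>simp_all only: lessThan_Suc_atMost norm_ge_zero\<close>)
  have d: "pair_norm (AL_prop c (Suc N) w (0,1) - AL_prop c N w (0,1)) \<le> exp K * cmod (c N)" if "w \<in> cball 0 1" for N w
  proof -
    have w: "cmod w \<le> 1" using that by simp
    have "AL_prop c (Suc N) w (0,1) - AL_prop c N w (0,1) = AL_prop c N w (w * c N, 0)"
      by (simp add: AL_step_def flip: AL_prop_diff)
    then have "pair_norm (AL_prop c (Suc N) w (0,1) - AL_prop c N w (0,1)) \<le> exp K * pair_norm (w * c N, 0)"
      using AL_prop_norm_bound[OF K w] by simp
    also have "\<dots> \<le> exp K * cmod (c N)"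
      using w by (intro mult_left_mono) (auto simp: pair_norm_def norm_mult mult_left_le_one_le)
    finally show ?thesis .
  qed
  show "uniform_limit (cball 0 1) (\<lambda>N w. fst (AL_prop c N w (0, 1))) (jost_fst c) sequentially"
    unfolding jost_fst_def[abs_def]
    by (rule uniform_limit_telescope[OF _ sm]) (metis d norm_fst_le_pair_norm fst_diff order_trans)
  show "uniform_limit (cball 0 1) (\<lambda>N w. snd (AL_prop c N w (0, 1))) (jost_snd c) sequentially"
    unfolding jost_snd_def[abs_def]
    by (rule uniform_limit_telescope[OF _ sm]) (metis d norm_snd_le_pair_norm snd_diff order_trans)
qed

lemma jost_holomorphic:
  assumes K: "\<And>N. (\<Sum>k<N. cmod (c k)) \<le> K"
  shows "continuous_on (cball 0 1) (jost_fst c)" "jost_fst c holomorphic_on ball 0 1"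
    "continuous_on (cball 0 1) (jost_snd c)" "jost_snd c holomorphic_on ball 0 1"
proof -
  have h: "(\<lambda>w. fst (AL_prop c N w (0,1))) holomorphic_on UNIV" "(\<lambda>w. snd (AL_prop c N w (0,1))) holomorphic_on UNIV" for N
    using AL_prop_holomorphic[of "\<lambda>_. (0,1)" UNIV c N] by auto
  have e: "\<forall>\<^sub>F N in sequentially. continuous_on (cball 0 1) (\<lambda>w. fst (AL_prop c N w (0,1))) \<and> (\<lambda>w. fst (AL_prop c N w (0,1))) holomorphic_on ball 0 1"
    "\<forall>\<^sub>F N in sequentially. continuous_on (cball 0 1) (\<lambda>w. snd (AL_prop c N w (0,1))) \<and> (\<lambda>w. snd (AL_prop c N w (0,1))) holomorphic_on ball 0 1"
    using h by (auto intro!: always_eventually intro: holomorphic_on_imp_continuous_on holomorphic_on_subset)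
  show "continuous_on (cball 0 1) (jost_fst c)" "jost_fst c holomorphic_on ball 0 1"
    by (rule holomorphic_uniform_limit[OF e(1) jost_uniform(1)[OF K]]; simp)+
  show "continuous_on (cball 0 1) (jost_snd c)" "jost_snd c holomorphic_on ball 0 1"
    by (rule holomorphic_uniform_limit[OF e(2) jost_uniform(2)[OF K]]; simp)+
qed

lemma jost_tendsto:
  assumes K: "\<And>N. (\<Sum>k<N. cmod (c k)) \<le> K" and w: "cmod w \<le> 1"
  shows "(\<lambda>N. fst (AL_prop c N w (0, 1))) \<longlonglongrightarrow> jost_fst c w" "(\<lambda>N. snd (AL_prop c N w (0, 1))) \<longlonglongrightarrow> jost_snd c w"
  using tendsto_uniform_limitI[OF jost_uniform(1)[OF K]] tendsto_uniform_limitI[OF jost_uniform(2)[OF K]] w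
  by auto

lemma jost_snd_0:
  assumes K: "\<And>N. (\<Sum>k<N. cmod (c k)) \<le> K" shows "jost_snd c 0 = 1"
  using jost_tendsto(2)[OF K, of 0] by (simp add: snd_AL_prop_0 LIMSEQ_const_iff)

text \<open>The recursion exposes a factor \<open>w\<close> whose cofactor takes the value
  \<open>c 0\<close> at the origin, because \<open>jost_snd\<close> is 1 there. The potential can
  thus be read off the Jost function.\<close>

lemma jost_fst_rec:
  assumes K: "\<And>N. (\<Sum>k<N. cmod (c k)) \<le> K" and K': "\<And>N. (\<Sum>k<N. cmod (c (Suc k))) \<le> K"
    and w: "cmod w \<le> 1"
  shows "jost_fst c w = w\<^sup>2 * jost_fst (\<lambda>k. c (Suc k)) w + w * c 0 * jost_snd (\<lambda>k. c (Suc k)) w"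
proof (rule LIMSEQ_unique)
  show "(\<lambda>N. fst (AL_prop c (Suc N) w (0, 1))) \<longlonglongrightarrow> jost_fst c w"
    using jost_tendsto(1)[OF K w] by (rule LIMSEQ_Suc)
  show "(\<lambda>N. fst (AL_prop c (Suc N) w (0, 1))) \<longlonglongrightarrow> w\<^sup>2 * jost_fst (\<lambda>k. c (Suc k)) w + w * c 0 * jost_snd (\<lambda>k. c (Suc k)) w"
    unfolding AL_prop_Suc_left AL_step_def fst_conv by (intro tendsto_intros jost_tendsto[OF K' w])
qed

text \<open>Unrolling \<open>N\<close> steps writes the scaled \<open>X 0\<close> as the transport
  of \<open>X N\<close>, and replacing \<open>X N\<close> by \<open>(0, 1)\<close> costs at most
  \<open>exp K\<close> times the distance to the limit. The factors \<open>s k\<close> make room for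
  the determinants \<open>1 - |R|^2\<close>, which occur on the right but not on the left.\<close>

lemma AL_prop_solution_limit:
  assumes K: "\<And>N. (\<Sum>k<N. cmod (c k)) \<le> K" and w: "cmod w \<le> 1"
    and X: "\<And>k. s k *\<^sub>R X k = AL_step (c k) w (X (Suc k))"
    and lim: "X \<longlonglongrightarrow> (0, 1)"
  shows "(\<lambda>N. (\<Prod>k<N. s k) *\<^sub>R X 0) \<longlonglongrightarrow> (jost_fst c w, jost_snd c w)"
proof -
  have eq: "(\<Prod>k<N. s k) *\<^sub>R X 0 = AL_prop c N w (X N)" for N
  proof (induction N)
    case (Suc N)
    have "(\<Prod>k<Suc N. s k) *\<^sub>R X 0 = s N *\<^sub>R AL_prop c N w (X N)"
      by (simp flip: Suc.IH add: mult.commute)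
    also have "\<dots> = AL_prop c N w (s N *\<^sub>R X N)" by (simp add: AL_prop_scale)
    finally show ?case by (simp add: X)
  qed simp
  have "(\<lambda>N. pair_norm (X N - (0,1))) \<longlonglongrightarrow> pair_norm ((0,1) - (0,1))"
    unfolding pair_norm_def by (intro tendsto_intros lim)
  then have lim0: "(\<lambda>N. exp K * pair_norm (X N - (0,1))) \<longlonglongrightarrow> 0"
    by (intro tendsto_mult_right_zero) (simp add: pair_norm_def)
  have b: "pair_norm (AL_prop c N w (X N) - AL_prop c N w (0,1)) \<le> exp K * pair_norm (X N - (0,1))" for N
    using AL_prop_norm_bound[OF K w] by (simp flip: AL_prop_diff)
  have "(\<lambda>N. fst (AL_prop c N w (X N)) - fst (AL_prop c N w (0,1))) \<longlonglongrightarrow> 0"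
    by (rule Lim_null_comparison[OF _ lim0]) (use order_trans[OF norm_fst_le_pair_norm b] in simp)
  from tendsto_add[OF this jost_tendsto(1)[OF K w]]
  have 1: "(\<lambda>N. fst (AL_prop c N w (X N))) \<longlonglongrightarrow> jost_fst c w" by simp
  have "(\<lambda>N. snd (AL_prop c N w (X N)) - snd (AL_prop c N w (0,1))) \<longlonglongrightarrow> 0"
    by (rule Lim_null_comparison[OF _ lim0]) (use order_trans[OF norm_snd_le_pair_norm b] in simp)
  from tendsto_add[OF this jost_tendsto(2)[OF K w]]
  have 2: "(\<lambda>N. snd (AL_prop c N w (X N))) \<longlonglongrightarrow> jost_snd c w" by simp
  from tendsto_Pair[OF 1 2] show ?thesis unfolding eq by simp
qed

lemma jost_hyp_tendsto:
  assumes K: "\<And>N. (\<Sum>k<N. cmod (c k)) \<le> K" and w: "cmod w \<le> 1"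
  shows "(\<lambda>N. pair_hyp (AL_prop c N w (0, 1))) \<longlonglongrightarrow> (cmod (jost_snd c w))\<^sup>2 - (cmod (jost_fst c w))\<^sup>2"
  unfolding pair_hyp_def by (intro tendsto_intros jost_tendsto[OF K w])

text \<open>On the circle every step multiplies the form by exactly \<open>1 - |c k|^2\<close>, so
  the limit is the same for all such \<open>w\<close>.\<close>

lemma jost_hyp_circle:
  assumes K: "\<And>N. (\<Sum>k<N. cmod (c k)) \<le> K" and w: "cmod w = 1"
  shows "(\<lambda>N. \<Prod>k<N. 1 - (cmod (c k))\<^sup>2) \<longlonglongrightarrow> (cmod (jost_snd c w))\<^sup>2 - (cmod (jost_fst c w))\<^sup>2"
  using jost_hyp_tendsto[OF K, of w] w by (simp add: AL_prop_hyp_circle) (simp add: pair_hyp_def)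

lemma jost_hyp_ge:
  assumes K: "\<And>N. (\<Sum>k<N. cmod (c k)) \<le> K" and w: "cmod w \<le> 1"
    and c: "\<And>k. cmod (c k) < 1" and d: "\<And>N. d \<le> (\<Prod>k<N. 1 - (cmod (c k))\<^sup>2)"
  shows "d \<le> (cmod (jost_snd c w))\<^sup>2 - (cmod (jost_fst c w))\<^sup>2"
proof (rule LIMSEQ_le_const[OF jost_hyp_tendsto[OF K w]], intro exI allI impI)
  fix N
  have "(\<Prod>k<N. 1 - (cmod (c k))\<^sup>2) * pair_hyp (0, 1) \<le> pair_hyp (AL_prop c N w (0, 1))"
    by (rule AL_prop_hyp_ge[OF w c])
  then show "d \<le> pair_hyp (AL_prop c N w (0, 1))" using d[of N] by (simp add: pair_hyp_def)
qed

lemma annulus_subset_open: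
  assumes "open S" "sphere (0::complex) 1 \<subseteq> S"
  obtains \<rho> where "0 < \<rho>" "\<rho> < 1" "\<And>w. \<rho> \<le> cmod w \<Longrightarrow> cmod w \<le> 1 \<Longrightarrow> w \<in> S"
proof -
  obtain e where e: "e > 0" "{x. infdist x (sphere (0::complex) 1) \<le> e} \<subseteq> S"
    using compact_in_open_separated[of "sphere (0::complex) 1" S] assms by auto
  \<comment> \<open>The bound 1/2 keeps \<open>\<rho>\<close> positive when \<open>e\<close> is
    large.\<close>
  define \<rho> where "\<rho> = max (1/2) (1 - e)"
  show ?thesis
  proof (rule that)
    show "0 < \<rho>" "\<rho> < 1" using e(1) by (auto simp: \<rho>_def)
    fix w :: complex assume w: "\<rho> \<le> cmod w" "cmod w \<le> 1"
    have nz: "cmod w > 0" using w(1) by (auto simp: \<rho>_def)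
    have "infdist w (sphere 0 1) \<le> dist w (w / of_real (cmod w))"
      by (rule infdist_le) (use nz in \<open>simp add: norm_divide\<close>)
    also have "w - w / of_real (cmod w) = of_real (cmod w - 1) * (w / of_real (cmod w))"
      using nz by (simp add: field_simps)
    then have "dist w (w / of_real (cmod w)) = \<bar>cmod w - 1\<bar>"
      using nz by (simp add: dist_norm norm_mult norm_divide del: of_real_diff)
    also have "\<dots> \<le> e" using w by (auto simp: \<rho>_def)
    finally show "w \<in> S" using e(2) by auto
  qed
qed

text \<open>Going from \<open>n + 1\<close> down to \<open>n\<close> inverts the transfer matrix,
  whose determinant is \<open>1 - |R n|^2\<close>. Multiplying by the determinant instead of
  dividing leaves a plain \<open>AL_step\<close> with \<open>c = - cnj (R n)\<close>, and the
  determinants collect in the product.\<close>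

lemma jost_solution_at_top:
  assumes ev: "AL_eigen R z \<psi>" and z: "z \<noteq> 0" and w: "w = inverse z" "cmod w \<le> 1"
    and K: "\<And>N. (\<Sum>k<N. cmod (- cnj (R (n + int k)))) \<le> K"
    and lim: "((\<lambda>n. (z powi n * fst (\<psi> n), z powi n * snd (\<psi> n))) \<longlongrightarrow> (0, 1)) at_top"
  shows "(\<lambda>N. (\<Prod>k<N. 1 - (cmod (R (n + int k)))\<^sup>2) *\<^sub>R (z powi n * fst (\<psi> n), z powi n * snd (\<psi> n)))
       \<longlonglongrightarrow> (jost_fst (\<lambda>k. - cnj (R (n + int k))) w, jost_snd (\<lambda>k. - cnj (R (n + int k))) w)"
proof -
  define \<Psi> where "\<Psi> m = (z powi m * fst (\<psi> m), z powi m * snd (\<psi> m))" for m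
  have st: "(1 - (cmod (R m))\<^sup>2) *\<^sub>R \<Psi> m = AL_step (- cnj (R m)) w (\<Psi> (m + 1))" for m
  proof -
    have wz: "w * z = 1" using w z by simp
    have c: "complex_of_real ((cmod (R m))\<^sup>2) = R m * cnj (R m)" by (simp only: complex_norm_square)
    have p: "\<psi> (m + 1) = (z * fst (\<psi> m) + cnj (R m) * snd (\<psi> m), R m * fst (\<psi> m) + w * snd (\<psi> m))"
      using ev w by (simp add: AL_eigen_def divide_inverse mult.commute)
    define Z where "Z = z powi m"
    have zz: "z powi (m + 1) = Z * z" using z by (simp add: Z_def power_int_add)
    have "w\<^sup>2 * (Z * z * (z * fst (\<psi> m) + cnj (R m) * snd (\<psi> m))) + w * - cnj (R m) * (Z * z * (R m * fst (\<psi> m) + w * snd (\<psi> m)))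
       = (w * z) * Z * ((w * z) * fst (\<psi> m) - R m * cnj (R m) * fst (\<psi> m))"
      by (simp add: algebra_simps power2_eq_square)
    moreover have "Z * z * (R m * fst (\<psi> m) + w * snd (\<psi> m)) + w * cnj (- cnj (R m)) * (Z * z * (z * fst (\<psi> m) + cnj (R m) * snd (\<psi> m)))
      = Z * z * R m * fst (\<psi> m) * (1 - w * z) + (w * z) * Z * (1 - R m * cnj (R m)) * snd (\<psi> m)"
      by (simp add: algebra_simps)
    ultimately show ?thesis
      unfolding \<Psi>_def AL_step_def p fst_conv snd_conv zz scaleR_Pair scaleR_conv_of_real of_real_diff of_real_1 c wz Z_def[symmetric]
      by (simp add: algebra_simps)
  qed
  have "(\<lambda>N. (\<Prod>k<N. 1 - (cmod (R (n + int k)))\<^sup>2) *\<^sub>R \<Psi> (n + int 0))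
     \<longlonglongrightarrow> (jost_fst (\<lambda>k. - cnj (R (n + int k))) w, jost_snd (\<lambda>k. - cnj (R (n + int k))) w)"
  proof (rule AL_prop_solution_limit[OF K w(2), where X = "\<lambda>k. \<Psi> (n + int k)"])
    show "(1 - (cmod (R (n + int k)))\<^sup>2) *\<^sub>R \<Psi> (n + int k) = AL_step (- cnj (R (n + int k))) w (\<Psi> (n + int (Suc k)))" for k
      using st[of "n + int k"] by (simp add: add_ac)
    have "filterlim (\<lambda>k. n + int k) at_top sequentially"
      unfolding filterlim_at_top eventually_sequentially
    proof
      fix Z show "\<exists>N. \<forall>k\<ge>N. Z \<le> n + int k" by (intro exI[of _ "nat (Z - n)"]) auto
    qed
    then show "(\<lambda>k. \<Psi> (n + int k)) \<longlonglongrightarrow> (0, 1)"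
      using lim unfolding \<Psi>_def by (rule filterlim_compose[rotated])
  qed
  then show ?thesis by (simp add: \<Psi>_def)
qed

text \<open>Coming from the left, the transfer matrix acts directly, so no determinants appear;
  swapping the components turns the limit \<open>(1, 0)\<close> into \<open>(0, 1)\<close>. The step
  into site \<open>n\<close> uses \<open>R (n - 1)\<close>, hence the coefficients start
  there.\<close>

lemma jost_solution_at_bot:
  assumes ev: "AL_eigen R z \<phi>" and z: "z \<noteq> 0" and w: "w = inverse z" "cmod w \<le> 1"
    and K: "\<And>N. (\<Sum>k<N. cmod (R (n - 1 - int k))) \<le> K"
    and lim: "((\<lambda>n. (z powi (-n) * fst (\<phi> n), z powi (-n) * snd (\<phi> n))) \<longlongrightarrow> (1, 0)) at_bot"
  shows "z powi (-n) * snd (\<phi> n) = jost_fst (\<lambda>k. R (n - 1 - int k)) w"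
    and "z powi (-n) * fst (\<phi> n) = jost_snd (\<lambda>k. R (n - 1 - int k)) w"
proof -
  define X where "X k = (z powi (-(n - int k)) * snd (\<phi> (n - int k)), z powi (-(n - int k)) * fst (\<phi> (n - int k)))" for k
  have st: "1 *\<^sub>R X k = AL_step (R (n - 1 - int k)) w (X (Suc k))" for k
  proof -
    define m where "m = n - 1 - int k"
    have m: "n - int k = m + 1" "n - int (Suc k) = m" by (auto simp: m_def)
    have wz: "w * z = 1" using w z by simp
    have p: "\<phi> (m + 1) = (z * fst (\<phi> m) + cnj (R m) * snd (\<phi> m), R m * fst (\<phi> m) + w * snd (\<phi> m))"
      using ev w by (simp add: AL_eigen_def divide_inverse mult.commute)
    define Z where "Z = z powi (- m)"
    have zz: "z powi (-(m + 1)) = Z * w"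
      using z w by (simp add: Z_def power_int_diff divide_inverse)
    have "Z * w * (z * fst (\<phi> m) + cnj (R m) * snd (\<phi> m)) = Z * (w * z) * fst (\<phi> m) + w * cnj (R m) * (Z * snd (\<phi> m))"
      by (simp add: algebra_simps)
    then show ?thesis
      unfolding X_def m p zz AL_step_def fst_conv snd_conv wz m_def[symmetric] Z_def[symmetric]
      by (simp add: algebra_simps power2_eq_square)
  qed
  have "filterlim (\<lambda>k. n - int k) at_bot sequentially"
    unfolding filterlim_at_bot eventually_sequentially
  proof
    fix Z show "\<exists>N. \<forall>k\<ge>N. n - int k \<le> Z" by (intro exI[of _ "nat (n - Z)"]) auto
  qed
  from filterlim_compose[OF lim this]
  have l: "(\<lambda>k. (z powi (-(n - int k)) * fst (\<phi> (n - int k)), z powi (-(n - int k)) * snd (\<phi> (n - int k)))) \<longlonglongrightarrow> (1, 0)"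
    by simp
  have "X \<longlonglongrightarrow> (0, 1)"
    unfolding X_def[abs_def] using tendsto_Pair[OF tendsto_snd[OF l] tendsto_fst[OF l]] by simp
  from AL_prop_solution_limit[OF K w(2) st this]
  have "X 0 = (jost_fst (\<lambda>k. R (n - 1 - int k)) w, jost_snd (\<lambda>k. R (n - 1 - int k)) w)"
    by (simp add: LIMSEQ_const_iff)
  then show "z powi (-n) * snd (\<phi> n) = jost_fst (\<lambda>k. R (n - 1 - int k)) w"
    "z powi (-n) * fst (\<phi> n) = jost_snd (\<lambda>k. R (n - 1 - int k)) w" by (auto simp: X_def)
qed

section \<open>Recovering the potential from the reflection coefficient\<close>

locale AL_scattering =
  fixes R :: "int \<Rightarrow> complex" and r :: "complex \<Rightarrow> complex" and K d :: real
  assumes small: "cmod (R n) < 1"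
    and summ: "finite A \<Longrightarrow> (\<Sum>n\<in>A. cmod (R n)) \<le> K"
    and prod_ge: "finite A \<Longrightarrow> d \<le> (\<Prod>n\<in>A. 1 - (cmod (R n))\<^sup>2)"
    and d: "d > 0"
    and refl: "is_reflection_coefficient R r"
begin

definition coeff_right :: "int \<Rightarrow> nat \<Rightarrow> complex" where "coeff_right n = (\<lambda>k. - cnj (R (n + int k)))"
definition coeff_left :: "int \<Rightarrow> nat \<Rightarrow> complex" where "coeff_left n = (\<lambda>k. R (n - 1 - int k))"

lemma sum_coeff_right: "(\<Sum>k<N. cmod (coeff_right n k)) \<le> K"
proof -
  have "(\<Sum>k<N. cmod (coeff_right n k)) = (\<Sum>m\<in>(\<lambda>k. n + int k) ` {..<N}. cmod (R m))"
    by (simp add: coeff_right_def sum.reindex inj_on_def)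
  then show ?thesis using summ by simp
qed

lemma sum_coeff_left: "(\<Sum>k<N. cmod (coeff_left n k)) \<le> K"
proof -
  have "(\<Sum>k<N. cmod (coeff_left n k)) = (\<Sum>m\<in>(\<lambda>k. n - 1 - int k) ` {..<N}. cmod (R m))"
    by (simp add: coeff_left_def sum.reindex inj_on_def)
  then show ?thesis using summ by simp
qed

lemma prod_coeff_right: "d \<le> (\<Prod>k<N. 1 - (cmod (coeff_right n k))\<^sup>2)"
proof -
  have "(\<Prod>k<N. 1 - (cmod (coeff_right n k))\<^sup>2) = (\<Prod>m\<in>(\<lambda>k. n + int k) ` {..<N}. 1 - (cmod (R m))\<^sup>2)"
    by (simp add: coeff_right_def prod.reindex inj_on_def)
  then show ?thesis using prod_ge by simp
qed

lemma prod_coeff_left: "d \<le> (\<Prod>k<N. 1 - (cmod (coeff_left n k))\<^sup>2)"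
proof -
  have "(\<Prod>k<N. 1 - (cmod (coeff_left n k))\<^sup>2) = (\<Prod>m\<in>(\<lambda>k. n - 1 - int k) ` {..<N}. 1 - (cmod (R m))\<^sup>2)"
    by (simp add: coeff_left_def prod.reindex inj_on_def)
  then show ?thesis using prod_ge by simp
qed

lemma jost_hyp_right: "cmod w \<le> 1 \<Longrightarrow> d \<le> (cmod (jost_snd (coeff_right n) w))\<^sup>2 - (cmod (jost_fst (coeff_right n) w))\<^sup>2"
  by (rule jost_hyp_ge[OF sum_coeff_right _ _ prod_coeff_right]) (auto simp: coeff_right_def small)

lemma jost_hyp_left: "cmod w \<le> 1 \<Longrightarrow> d \<le> (cmod (jost_snd (coeff_left n) w))\<^sup>2 - (cmod (jost_fst (coeff_left n) w))\<^sup>2"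
  by (rule jost_hyp_ge[OF sum_coeff_left _ _ prod_coeff_left]) (auto simp: coeff_left_def small)

text \<open>The Wronskian of \<open>\<phi>\<close> and \<open>\<psi>\<close>, scaled so that it equals the scattering coefficient \<open>a\<close>
  on the circle. It has no zeros in the closed disc because the problem is defocusing.\<close>
definition scat_a :: "int \<Rightarrow> complex \<Rightarrow> complex" where
  "scat_a n w = jost_snd (coeff_left n) w * jost_snd (coeff_right n) w - jost_fst (coeff_left n) w * jost_fst (coeff_right n) w"

text \<open>At both ends the lower bound \<open>d > 0\<close> for the form makes the second
  component strictly larger in modulus than the first, so the two products cannot have equal
  modulus.\<close>

lemma scat_a_nonzero:
  assumes "cmod w \<le> 1" shows "scat_a n w \<noteq> 0"
proof
  assume "scat_a n w = 0"
  then have "cmod (jost_snd (coeff_left n) w) * cmod (jost_snd (coeff_right n) w) = cmod (jost_fst (coeff_left n) w) * cmod (jost_fst (coeff_right n) w)"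
    by (metis scat_a_def eq_iff_diff_eq_0 norm_mult)
  moreover have "cmod (jost_fst (coeff_right n) w) < cmod (jost_snd (coeff_right n) w)"
    by (rule power_less_imp_less_base[where n=2]) (use jost_hyp_right[OF assms, of n] d in auto)
  moreover have "cmod (jost_fst (coeff_left n) w) < cmod (jost_snd (coeff_left n) w)"
    by (rule power_less_imp_less_base[where n=2]) (use jost_hyp_left[OF assms, of n] d in auto)
  ultimately show False
    by (metis less_irrefl mult_strict_mono' norm_ge_zero)
qed

text \<open>The infinite product of \<open>1 - |R m|^2\<close> over \<open>m \<ge> n\<close>. The
  point 1 is a mere choice, since the value is the same on the whole circle.\<close>

definition jost_det :: "int \<Rightarrow> real" where "jost_det n = (cmod (jost_snd (coeff_right n) 1))\<^sup>2 - (cmod (jost_fst (coeff_right n) 1))\<^sup>2"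

lemma jost_det_tendsto: "(\<lambda>N. \<Prod>k<N. 1 - (cmod (coeff_right n k))\<^sup>2) \<longlonglongrightarrow> jost_det n"
  unfolding jost_det_def by (rule jost_hyp_circle[OF sum_coeff_right]) simp

lemma jost_det_pos: "jost_det n > 0" using jost_hyp_right[of 1 n] d unfolding jost_det_def by simp

lemma jost_det_eq: "cmod w = 1 \<Longrightarrow> (cmod (jost_snd (coeff_right n) w))\<^sup>2 - (cmod (jost_fst (coeff_right n) w))\<^sup>2 = jost_det n"
  using LIMSEQ_unique[OF jost_det_tendsto jost_hyp_circle[OF sum_coeff_right, of w n]] by simp

text \<open>Scaled by \<open>jost_det n\<close>, the relation between \<open>\<phi>\<close>,
  \<open>\<psi>b\<close> and \<open>\<psi>\<close> at site \<open>n\<close> is a pair of linear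
  equations in \<open>a\<close> and \<open>b\<close>. Eliminating \<open>b\<close> identifies
  \<open>a\<close> with \<open>scat_a n w\<close>; the second equation divided by \<open>a\<close>
  is the claim.\<close>

lemma scattering_identity:
  assumes w: "cmod w = 1" and n: "n \<ge> 0"
  shows "cnj (jost_fst (coeff_right n) w) + r (inverse w) * w ^ (2 * nat n) * jost_snd (coeff_right n) w = jost_det n * jost_fst (coeff_left n) w / scat_a n w"
proof -
  define z where "z = inverse w"
  have w0: "w \<noteq> 0" using w by auto
  have "cnj w = z" using divide_conv_cnj[OF w, of 1] by (simp add: z_def inverse_eq_divide)
  have z: "cmod z = 1" "z \<noteq> 0" "w = inverse z" "cnj z = w"
    using w w0 \<open>cnj w = z\<close> by (auto simp: z_def norm_inverse simp flip: \<open>cnj w = z\<close>)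
  obtain \<phi> \<psi> \<psi>b a b where E: "AL_eigen R z \<phi>" "AL_eigen R z \<psi>" "AL_eigen R z \<psi>b"
    and l\<phi>: "((\<lambda>n. (z powi (-n) * fst (\<phi> n), z powi (-n) * snd (\<phi> n))) \<longlongrightarrow> (1, 0)) at_bot"
    and l\<psi>: "((\<lambda>n. (z powi n * fst (\<psi> n), z powi n * snd (\<psi> n))) \<longlongrightarrow> (0, 1)) at_top"
    and l\<psi>b: "((\<lambda>n. (z powi (-n) * fst (\<psi>b n), z powi (-n) * snd (\<psi>b n))) \<longlongrightarrow> (1, 0)) at_top"
    and ab: "\<And>n. \<phi> n = (a * fst (\<psi>b n) + b * fst (\<psi> n), a * snd (\<psi>b n) + b * snd (\<psi> n))"
    and r: "r z = b / a"
    using refl z(1) unfolding is_reflection_coefficient_def by blast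
  \<comment> \<open>Since \<open>cnj z = 1 / z\<close>, conjugating and swapping the components of
    \<open>\<psi>b\<close> gives a solution with the asymptotics of \<open>\<psi>\<close>, so
    \<open>\<psi>b\<close> is given by the conjugates of the same Jost functions.\<close>
  define \<omega> where "\<omega> m = (cnj (snd (\<psi>b m)), cnj (fst (\<psi>b m)))" for m
  have czi: "cnj (z powi (- m)) = z powi m" for m
  proof -
    have "cnj (z powi (- m)) = w powi (- m)" by (simp add: power_int_def z(4))
    also have "\<dots> = z powi m" by (simp add: z(3) power_int_minus power_int_inverse)
    finally show ?thesis .
  qed
  have \<omega>: "AL_eigen R z \<omega>"
    unfolding AL_eigen_def
  proof
    fix m
    have dv: "x / z = w * x" for x by (simp add: z(3) divide_inverse mult.commute)
    have "\<psi>b (m + 1) = (z * fst (\<psi>b m) + cnj (R m) * snd (\<psi>b m), R m * fst (\<psi>b m) + w * snd (\<psi>b m))"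
      using E(3) unfolding AL_eigen_def dv by blast
    then show "\<omega> (m + 1) = (z * fst (\<omega> m) + cnj (R m) * snd (\<omega> m), R m * fst (\<omega> m) + snd (\<omega> m) / z)"
      unfolding \<omega>_def dv by (simp only: fst_conv snd_conv complex_cnj_add complex_cnj_mult
          complex_cnj_cnj z(4) \<open>cnj w = z\<close> add.commute)
  qed
  have l\<omega>: "((\<lambda>n. (z powi n * fst (\<omega> n), z powi n * snd (\<omega> n))) \<longlongrightarrow> (0, 1)) at_top"
  proof -
    have "((\<lambda>n. (cnj (z powi (-n) * snd (\<psi>b n)), cnj (z powi (-n) * fst (\<psi>b n)))) \<longlongrightarrow> (cnj 0, cnj 1)) at_top"
      using tendsto_fst[OF l\<psi>b] tendsto_snd[OF l\<psi>b] by (intro tendsto_Pair tendsto_cnj) auto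
    then show ?thesis by (simp only: complex_cnj_mult czi \<omega>_def fst_conv snd_conv complex_cnj_zero complex_cnj_one)
  qed
  have top: "jost_det n * (z powi n * fst (\<xi> n)) = jost_fst (coeff_right n) w \<and> jost_det n * (z powi n * snd (\<xi> n)) = jost_snd (coeff_right n) w"
    if "AL_eigen R z \<xi>" "((\<lambda>n. (z powi n * fst (\<xi> n), z powi n * snd (\<xi> n))) \<longlongrightarrow> (0, 1)) at_top" for \<xi>
  proof -
    have "(\<lambda>N. (\<Prod>k<N. 1 - (cmod (R (n + int k)))\<^sup>2) *\<^sub>R (z powi n * fst (\<xi> n), z powi n * snd (\<xi> n)))
       \<longlonglongrightarrow> (jost_fst (coeff_right n) w, jost_snd (coeff_right n) w)"
      using jost_solution_at_top[OF that(1) z(2,3) _ _ that(2), of n K] w sum_coeff_right[of n] by (simp add: coeff_right_def)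
    moreover have "(\<lambda>N. (\<Prod>k<N. 1 - (cmod (R (n + int k)))\<^sup>2) *\<^sub>R (z powi n * fst (\<xi> n), z powi n * snd (\<xi> n)))
       \<longlonglongrightarrow> jost_det n *\<^sub>R (z powi n * fst (\<xi> n), z powi n * snd (\<xi> n))"
      using jost_det_tendsto[of n] by (intro tendsto_intros) (simp add: coeff_right_def)
    ultimately have "jost_det n *\<^sub>R (z powi n * fst (\<xi> n), z powi n * snd (\<xi> n)) = (jost_fst (coeff_right n) w, jost_snd (coeff_right n) w)"
      by (rule LIMSEQ_unique[rotated])
    then show ?thesis by (simp add: scaleR_conv_of_real)
  qed
  define A where "A = jost_snd (coeff_left n) w"
  define B where "B = jost_fst (coeff_left n) w"
  define p where "p = jost_fst (coeff_right n) w"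
  define q where "q = jost_snd (coeff_right n) w"
  define D where "D = complex_of_real (jost_det n)"
  define Z where "Z = w ^ (2 * nat n)"
  have bot: "z powi (-n) * snd (\<phi> n) = B" "z powi (-n) * fst (\<phi> n) = A"
    using jost_solution_at_bot[OF E(1) z(2,3) _ _ l\<phi>, of n K] w sum_coeff_left[of n]
    by (auto simp: A_def B_def coeff_left_def)
  \<comment> \<open>\<open>\<phi>\<close> and \<open>\<psi>b\<close> are scaled by
    \<open>z powi (-n)\<close> but \<open>\<psi>\<close> by \<open>z powi n\<close>; the mismatch is
    \<open>w ^ (2 * nat n)\<close>, a natural power because \<open>n \<ge> 0\<close>.\<close>
  have zn: "z powi (-n) = Z * z powi n"
  proof -
    have "z powi (-n) = w ^ nat n" using n z(3) by (simp add: power_int_def power_inverse)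
    moreover have "z powi n = inverse (w ^ nat n)" using n by (simp add: z_def power_int_def power_inverse)
    ultimately show ?thesis using w0 by (simp add: Z_def power_add mult_2)
  qed
  have \<psi>: "D * (z powi n * fst (\<psi> n)) = p" "D * (z powi n * snd (\<psi> n)) = q"
    using top[OF E(2) l\<psi>] by (auto simp: D_def p_def q_def)
  have \<psi>b: "D * (z powi (-n) * snd (\<psi>b n)) = cnj p" "D * (z powi (-n) * fst (\<psi>b n)) = cnj q"
  proof -
    have t: "D * (z powi n * cnj (snd (\<psi>b n))) = p" "D * (z powi n * cnj (fst (\<psi>b n))) = q"
      using top[OF \<omega> l\<omega>] by (auto simp: D_def p_def q_def \<omega>_def)
    have "cnj (z powi n) = z powi (- n)" using czi[of "-n"] by simp
    then show "D * (z powi (-n) * snd (\<psi>b n)) = cnj p" "D * (z powi (-n) * fst (\<psi>b n)) = cnj q"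
      unfolding t[symmetric] by (simp_all add: D_def)
  qed
  have DA: "D * A = a * cnj q + b * Z * p"
    unfolding bot(2)[symmetric] \<psi>(1)[symmetric] \<psi>b(2)[symmetric] ab[of n] fst_conv
    by (simp only: zn distrib_left mult_ac)
  have DB: "D * B = a * cnj p + b * Z * q"
    unfolding bot(1)[symmetric] \<psi>(2)[symmetric] \<psi>b(1)[symmetric] ab[of n] snd_conv
    by (simp only: zn distrib_left mult_ac)
  have qp: "q * cnj q - p * cnj p = D"
    unfolding D_def jost_det_eq[OF w, of n, symmetric] p_def q_def by (simp only: complex_norm_square of_real_diff)
  have D0: "D \<noteq> 0" using jost_det_pos[of n] by (simp add: D_def)
  have "D * scat_a n w = (D * A) * q - (D * B) * p"
    by (simp add: scat_a_def A_def B_def p_def q_def algebra_simps)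
  also have "\<dots> = a * (q * cnj q - p * cnj p)" unfolding DA DB by (simp add: algebra_simps)
  finally have a: "a = scat_a n w" using D0 qp by simp
  \<comment> \<open>This makes \<open>b / a\<close> a genuine quotient rather than the default value
    of division by zero.\<close>
  have a0: "a \<noteq> 0" using scat_a_nonzero[of w n] w a by simp
  have "cnj p + b / a * Z * q = D * B / a" using a0 unfolding DB by (simp add: field_simps)
  then show ?thesis using r a by (simp add: z_def p_def q_def D_def B_def Z_def)
qed

text \<open>Multiplied by \<open>w\<close>, the right side of \<open>scattering_identity\<close> is
  holomorphic in the disc and vanishes at 0, so its mean is 0. The conjugated Jost term becomes
  \<open>cnj (G w)\<close>; in \<open>G\<close> the factor \<open>cnj w\<close> cancels one
  \<open>w\<close> of \<open>jost_fst_rec\<close>, so the mean of \<open>cnj (G w)\<close> is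
  \<open>cnj (- cnj (R n)) = - R n\<close>. The remaining term must have mean
  \<open>R n\<close>.\<close>

lemma potential_eq_circ_mean:
  assumes n: "n \<ge> 0"
  shows "R n = circ_mean (\<lambda>w. r (inverse w) * w ^ (2 * nat n + 1) * jost_snd (coeff_right n) w)"
proof -
  define H where "H w = w * (jost_det n * jost_fst (coeff_left n) w / scat_a n w)" for w
  define G where "G w = cnj w * jost_fst (coeff_right n) w" for w
  note hR = jost_holomorphic[OF sum_coeff_right[of n]] and hL = jost_holomorphic[OF sum_coeff_left[of n]]
  have "continuous_on (cball 0 1) (scat_a n)" "scat_a n holomorphic_on ball 0 1"
    unfolding scat_a_def[abs_def] by (intro continuous_intros holomorphic_intros hR hL)+
  then have H: "continuous_on (cball 0 1) H" "H holomorphic_on ball 0 1"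
    unfolding H_def[abs_def] using hL scat_a_nonzero
    by (auto intro!: continuous_intros holomorphic_intros)
  have contG: "continuous_on (sphere 0 1) G"
    unfolding G_def[abs_def] by (intro continuous_intros continuous_on_subset[OF hR(1)]) auto
  have mG: "circ_mean G = coeff_right n 0"
  proof -
    define c' where "c' = (\<lambda>k. coeff_right n (Suc k))"
    have c'_eq: "c' = coeff_right (n + 1)" by (auto simp: c'_def coeff_right_def add_ac)
    note h = jost_holomorphic[OF sum_coeff_right[of "n + 1"], folded c'_eq]
    have "circ_mean G = circ_mean (\<lambda>w. w * jost_fst c' w + coeff_right n 0 * jost_snd c' w)"
    proof (rule circ_mean_cong)
      fix w :: complex assume "w \<in> sphere 0 1"
      then have w: "cmod w = 1" by simp
      then have cw: "cnj w * w = 1" by (metis complex_norm_square mult.commute of_real_1 one_power2)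
      have rec: "jost_fst (coeff_right n) w = w\<^sup>2 * jost_fst c' w + w * coeff_right n 0 * jost_snd c' w"
        unfolding c'_def
        by (rule jost_fst_rec[OF sum_coeff_right]) (use sum_coeff_right[of "n + 1", folded c'_eq] w in \<open>auto simp: c'_def\<close>)
      have "G w = (cnj w * w) * (w * jost_fst c' w + coeff_right n 0 * jost_snd c' w)"
        unfolding G_def rec by (simp add: algebra_simps power2_eq_square)
      then show "G w = w * jost_fst c' w + coeff_right n 0 * jost_snd c' w" using cw by simp
    qed
    also have "\<dots> = 0 * jost_fst c' 0 + coeff_right n 0 * jost_snd c' 0"
      by (rule circ_mean_holomorphic) (intro continuous_intros holomorphic_intros h)+
    also have "jost_snd c' 0 = 1" unfolding c'_eq by (rule jost_snd_0[OF sum_coeff_right])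
    finally show ?thesis by simp
  qed
  have "circ_mean (\<lambda>w. r (inverse w) * w ^ (2 * nat n + 1) * jost_snd (coeff_right n) w) = circ_mean (\<lambda>w. H w - cnj (G w))"
  proof (rule circ_mean_cong)
    fix w :: complex assume "w \<in> sphere 0 1"
    then have w: "cmod w = 1" by simp
    have "H w - cnj (G w) = w * (jost_det n * jost_fst (coeff_left n) w / scat_a n w - cnj (jost_fst (coeff_right n) w))"
      by (simp add: H_def G_def algebra_simps)
    also have "\<dots> = w * (r (inverse w) * w ^ (2 * nat n) * jost_snd (coeff_right n) w)"
      unfolding scattering_identity[OF w n, symmetric] by simp
    finally show "r (inverse w) * w ^ (2 * nat n + 1) * jost_snd (coeff_right n) w = H w - cnj (G w)" by (simp add: mult_ac)
  qed
  also have "\<dots> = circ_mean H - circ_mean (\<lambda>w. cnj (G w))"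
    using H contG by (intro circ_mean_diff continuous_on_cnj) (auto intro: continuous_on_subset)
  also have "\<dots> = R n"
    unfolding circ_mean_cnj mG circ_mean_holomorphic[OF H] by (simp add: H_def coeff_right_def)
  finally show ?thesis by simp
qed

text \<open>\<open>jost_holomorphic\<close> gives holomorphy of \<open>jost_snd\<close> in the open
  disc only, so the circle is shrunk for its entire approximants \<open>q N\<close>, all bounded by
  \<open>exp K\<close> on the closed disc, and the uniform limit is taken afterwards.\<close>

lemma potential_exponential_decay:
  assumes "analytic_on_circle r"
  shows "\<exists>\<rho> C. 0 < \<rho> \<and> \<rho> < 1 \<and> C > 0 \<and> (\<forall>n\<ge>0. cmod (R n) \<le> C * \<rho> ^ nat n)"
proof -
  obtain S f where S: "open S" "sphere 0 1 \<subseteq> S" "f holomorphic_on S" "\<And>z. z \<in> sphere 0 1 \<Longrightarrow> f z = r z"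
    using assms unfolding analytic_on_circle_def by blast
  \<comment> \<open>\<open>r\<close> enters at \<open>1 / w\<close>, so its extension is pulled back
    along inversion.\<close>
  define S' where "S' = - {0} \<inter> inverse -` S"
  define g where "g w = f (inverse w)" for w
  have S': "open S'" unfolding S'_def
    by (rule continuous_open_preimage[OF _ _ S(1)]) (auto intro!: continuous_intros)
  have sp: "sphere 0 1 \<subseteq> S'" using S(2) by (auto simp: S'_def norm_inverse subset_iff)
  have gh: "g holomorphic_on S'"
    unfolding g_def[abs_def]
    by (rule holomorphic_on_compose_gen[of inverse S' f S, unfolded o_def])
       (auto simp: S'_def S(3) intro!: holomorphic_intros)
  obtain \<rho> where \<rho>: "0 < \<rho>" "\<rho> < 1" "\<And>w. \<rho> \<le> cmod w \<Longrightarrow> cmod w \<le> 1 \<Longrightarrow> w \<in> S'"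
    using annulus_subset_open[OF S' sp] by blast
  define An where "An = cball (0::complex) 1 - ball 0 \<rho>"
  have "compact An" unfolding An_def by (intro compact_diff) auto
  moreover have "continuous_on An g"
    by (rule continuous_on_subset[OF holomorphic_on_imp_continuous_on[OF gh]]) (use \<rho>(3) in \<open>auto simp: An_def\<close>)
  ultimately have "bounded (g ` An)" by (intro compact_imp_bounded compact_continuous_image)
  then obtain G where G: "G > 0" "\<And>w. w \<in> An \<Longrightarrow> cmod (g w) \<le> G"
    unfolding bounded_pos by auto
  have gc: "continuous_on (sphere 0 1) g"
    by (rule continuous_on_subset[OF holomorphic_on_imp_continuous_on[OF gh] sp])
  have "cmod (R n) \<le> G * exp K * \<rho> ^ nat n" if n: "n \<ge> 0" for n
  proof -
    define m where "m = 2 * nat n + 1"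
    define q where "q N w = snd (AL_prop (coeff_right n) N w (0, 1))" for N w
    define h where "h N w = g w * w ^ m * q N w" for N w
    have qh: "q N holomorphic_on UNIV" for N
      unfolding q_def[abs_def] using AL_prop_holomorphic[of "\<lambda>_. (0,1)" UNIV "coeff_right n" N] by auto
    have qb: "cmod (q N w) \<le> exp K" if "cmod w \<le> 1" for N w
    proof -
      have "cmod (q N w) \<le> pair_norm (AL_prop (coeff_right n) N w (0, 1))" unfolding q_def by (rule norm_snd_le_pair_norm)
      also have "\<dots> \<le> exp K * pair_norm (0, 1)" by (rule AL_prop_norm_bound[OF sum_coeff_right that])
      finally show ?thesis by (simp add: pair_norm_def)
    qed
    have hh: "h N holomorphic_on S'" for N
      unfolding h_def[abs_def] by (intro holomorphic_intros gh holomorphic_on_subset[OF qh]) auto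
    have hc: "continuous_on (sphere 0 1) (h N)" for N
      by (rule continuous_on_subset[OF holomorphic_on_imp_continuous_on[OF hh] sp])
    have bN: "cmod (circ_mean (h N)) \<le> G * exp K * \<rho> ^ nat n" for N
    proof -
      have "circ_mean (h N) = circ_mean (\<lambda>w. h N (\<rho> * w))"
        by (rule circ_mean_shift[OF S' hh]) (use \<rho> in auto)
      also have "cmod \<dots> \<le> G * exp K * \<rho> ^ nat n"
      proof (rule circ_mean_norm_le)
        show "continuous_on (sphere 0 1) (\<lambda>w::complex. h N (\<rho> * w))"
          by (rule continuous_on_compose2[OF holomorphic_on_imp_continuous_on[OF hh]])
             (use \<rho> in \<open>auto intro!: continuous_intros \<rho>(3) simp: norm_mult\<close>)
        fix w :: complex assume "w \<in> sphere 0 1"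
        then have w: "cmod (\<rho> * w) = \<rho>" using \<rho> by (simp add: norm_mult)
        have "cmod (h N (\<rho> * w)) = cmod (g (\<rho> * w)) * \<rho> ^ m * cmod (q N (\<rho> * w))"
          unfolding h_def norm_mult[of "g (\<rho> * w) * (\<rho> * w) ^ m"] norm_mult[of "g (\<rho> * w)"] norm_power w ..
        also have "\<dots> \<le> G * \<rho> ^ nat n * exp K"
        proof (intro mult_mono)
          show "cmod (g (\<rho> * w)) \<le> G" using w \<rho> by (intro G) (auto simp: An_def)
          \<comment> \<open>The integrand offers the exponent \<open>2 * nat n + 1\<close>, of which
            only \<open>nat n\<close> is kept.\<close>
          show "\<rho> ^ m \<le> \<rho> ^ nat n" using \<rho> by (intro power_decreasing) (auto simp: m_def)
          show "cmod (q N (\<rho> * w)) \<le> exp K" using w \<rho> by (intro qb) auto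
        qed (use G \<rho> in auto)
        finally show "cmod (h N (\<rho> * w)) \<le> G * exp K * \<rho> ^ nat n" by (simp add: mult_ac)
      qed
      finally show ?thesis .
    qed
    define h_lim where "h_lim w = g w * w ^ m * jost_snd (coeff_right n) w" for w
    have h_limc: "continuous_on (sphere 0 1) h_lim"
      unfolding h_lim_def[abs_def]
      by (intro continuous_intros gc continuous_on_subset[OF jost_holomorphic(3)[OF sum_coeff_right]]) auto
    have Rn: "R n = circ_mean h_lim"
      unfolding potential_eq_circ_mean[OF n]
      by (rule circ_mean_cong) (auto simp: h_lim_def m_def g_def S(4) norm_inverse)
    have "cmod (R n) \<le> G * exp K * \<rho> ^ nat n + e" if e: "e > 0" for e
    proof -
      \<comment> \<open>Accuracy \<open>e / G\<close> absorbs the bound \<open>G\<close> on the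
        factor \<open>g\<close>.\<close>
      have "\<forall>\<^sub>F N in sequentially. \<forall>w\<in>cball 0 1. dist (q N w) (jost_snd (coeff_right n) w) < e / G"
        using jost_uniform(2)[OF sum_coeff_right[of n]] e G(1) unfolding uniform_limit_iff q_def by auto
      then obtain N where N: "\<And>w. w \<in> cball 0 1 \<Longrightarrow> dist (q N w) (jost_snd (coeff_right n) w) < e / G"
        unfolding eventually_sequentially by blast
      have "cmod (circ_mean (\<lambda>w. h_lim w - h N w)) \<le> e"
      proof (rule circ_mean_norm_le)
        show "continuous_on (sphere 0 1) (\<lambda>w. h_lim w - h N w)" by (intro continuous_intros h_limc hc)
        fix w :: complex assume w: "w \<in> sphere 0 1"
        have "cmod (h_lim w - h N w) = cmod (g w) * cmod (jost_snd (coeff_right n) w - q N w)"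
          using w by (simp add: h_lim_def h_def norm_mult norm_power flip: right_diff_distrib)
        also have "\<dots> \<le> G * (e / G)"
          using w N[of w] \<rho> G by (intro mult_mono) (auto simp: An_def dist_norm norm_minus_commute less_imp_le)
        finally show "cmod (h_lim w - h N w) \<le> e" using G(1) by simp
      qed
      then have "cmod (circ_mean h_lim - circ_mean (h N)) \<le> e"
        by (simp add: circ_mean_diff[OF h_limc hc])
      then show ?thesis using bN[of N] norm_triangle_sub[of "circ_mean h_lim" "circ_mean (h N)"]
        unfolding Rn by linarith
    qed
    then show ?thesis by (rule field_le_epsilon)
  qed
  then show ?thesis using \<rho> G(1) by (intro exI[of _ \<rho>] exI[of _ "G * exp K"]) auto
qed

end

section \<open>Decay in Region C\<close>

theorem theorem2p2:
  fixes R :: "int \<Rightarrow> real \<Rightarrow> complex" and r :: "complex \<Rightarrow> complex" and V\<^sub>0 :: real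
  assumes ode: "\<forall>n. \<forall>t\<ge>0. ((\<lambda>s. R n s) has_vector_derivative
              (\<i> * ((R (n + 1) t - 2 * R n t + R (n - 1) t)
                    - (cmod (R n t))\<^sup>2 * (R (n + 1) t + R (n - 1) t)))) (at t within {0..})"
    and bounded: "\<forall>T. \<exists>M. \<forall>n. \<forall>t\<in>{0..T}. cmod (R n t) \<le> M"
    and small: "\<forall>n. cmod (R n 0) < 1"
    and decay: "\<forall>s>0. \<exists>C>0. \<forall>n. cmod (R n 0) \<le> C * (1 + \<bar>real_of_int n\<bar>) powr (- s)"
    and refl: "is_reflection_coefficient (\<lambda>n. R n 0) r"
    and V0: "V\<^sub>0 > 0"
  shows "(\<forall>j::nat. j \<ge> 1 \<longrightarrow>
            (\<exists>C>0. \<forall>n t. 0 \<le> t \<longrightarrow> real_of_int n > (2 + V\<^sub>0) * t \<longrightarrow>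
               cmod (R n t) \<le> C / real_of_int n ^ j))
       \<and> (analytic_on_circle r \<longrightarrow>
            (\<exists>\<rho> C. 0 < \<rho> \<and> \<rho> < 1 \<and> C > 0 \<and>
               (\<forall>n t. 0 \<le> t \<longrightarrow> real_of_int n > (2 + V\<^sub>0) * t \<longrightarrow>
                  cmod (R n t) \<le> C * \<rho> powr real_of_int n)))"
proof -
  obtain Z where Z: "Z > 0" "\<And>A::int set. finite A \<Longrightarrow> (\<Sum>n\<in>A. 1 / (1 + \<bar>real_of_int n\<bar>)\<^sup>2) \<le> Z"
    using sum_int_inverse_square_bounded by blast
  obtain C\<^sub>2 where C2: "C\<^sub>2 > 0" "\<And>n. cmod (R n 0) \<le> C\<^sub>2 * (1 + \<bar>real_of_int n\<bar>) powr (- 2)"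
    using decay[rule_format, of 2] by auto
  \<comment> \<open>Decay of order 2 can be summed over the integers and supplies the constant
    \<open>K\<close> of both locales.\<close>
  have "(\<Sum>n\<in>A. cmod (R n 0)) \<le> C\<^sub>2 * Z" if "finite A" for A
  proof -
    have "(\<Sum>n\<in>A. cmod (R n 0)) \<le> (\<Sum>n\<in>A. C\<^sub>2 * (1 / (1 + \<bar>real_of_int n\<bar>)\<^sup>2))"
      using C2(2) by (intro sum_mono) (simp add: powr_minus_divide)
    also have "\<dots> \<le> C\<^sub>2 * Z"
      unfolding sum_distrib_left[symmetric] using C2(1) Z(2)[OF that] by (intro mult_left_mono) auto
    finally show ?thesis .
  qed
  then interpret AL_flow R "C\<^sub>2 * Z"
    using ode small by unfold_locales auto
  obtain C \<eta> \<kappa> where C: "C > 0" "\<eta> > 0" "\<kappa> > 0"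
    and cone: "\<And>N t g. 0 \<le> t \<Longrightarrow> real_of_int N > (2 + V\<^sub>0) * t \<Longrightarrow> g \<ge> 0 \<Longrightarrow>
     (\<And>k. real_of_int k \<ge> \<eta> * real_of_int N \<Longrightarrow> cmod (R k 0) \<le> g) \<Longrightarrow>
     (cmod (R N t))\<^sup>2 \<le> C * (g + exp (- (\<kappa> * real_of_int N)))"
    using light_cone_bound[OF V0] by blast
  have posN: "real_of_int N > 0" if "0 \<le> t" "real_of_int N > (2 + V\<^sub>0) * t" for N t
    using that V0 by (smt (verit) mult_nonneg_nonneg)
  show ?thesis
  proof (intro conjI allI impI)
    fix j :: nat assume j: "j \<ge> 1"
    \<comment> \<open>The light cone estimate controls the square of the modulus, so order
      \<open>2 * j\<close> of the initial data yields order \<open>j\<close>.\<close>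
    define m where "m = 2 * j"
    have m: "m > 0" using j by (simp add: m_def)
    obtain C\<^sub>1 where C1: "C\<^sub>1 > 0" "\<And>n. cmod (R n 0) \<le> C\<^sub>1 * (1 + \<bar>real_of_int n\<bar>) powr (- real m)"
      using decay[rule_format, of "real m"] m by auto
    define B where "B = C * (C\<^sub>1 / \<eta> ^ m + (real m / \<kappa>) ^ m)"
    have B: "B > 0" using C C1 m by (auto simp: B_def intro!: mult_pos_pos add_pos_pos divide_pos_pos)
    have "cmod (R N t) \<le> sqrt B / real_of_int N ^ j"
      if t: "0 \<le> t" and N: "real_of_int N > (2 + V\<^sub>0) * t" for N t
    proof -
      define x where "x = real_of_int N"
      have x: "x > 0" using posN[OF t N] by (simp add: x_def)
      have "cmod (R k 0) \<le> C\<^sub>1 / (\<eta> * x) ^ m" if k: "real_of_int k \<ge> \<eta> * x" for k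
      proof -
        have "(\<eta> * x) ^ m \<le> (1 + \<bar>real_of_int k\<bar>) ^ m"
          using k C x by (intro power_mono) auto
        then have "C\<^sub>1 / (1 + \<bar>real_of_int k\<bar>) ^ m \<le> C\<^sub>1 / (\<eta> * x) ^ m"
          using C1 C x by (intro divide_left_mono mult_pos_pos) auto
        then show ?thesis using C1(2)[of k] by (simp add: powr_minus_divide powr_realpow)
      qed
      then have "(cmod (R N t))\<^sup>2 \<le> C * (C\<^sub>1 / (\<eta> * x) ^ m + exp (- (\<kappa> * x)))"
        using cone[OF t N, of "C\<^sub>1 / (\<eta> * x) ^ m"] C C1 x unfolding x_def by auto
      also have "\<dots> \<le> C * (C\<^sub>1 / (\<eta> * x) ^ m + (real m / (\<kappa> * x)) ^ m)"
      proof -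
        \<comment> \<open>The exponential is split into \<open>m\<close> equal factors, each at most
          \<open>1 / y\<close>, which turns it into a power of \<open>1 / x\<close>.\<close>
        define y where "y = \<kappa> * x / real m"
        have y: "y > 0" using C x m by (simp add: y_def)
        have "exp (- (\<kappa> * x)) = exp (- y) ^ m"
          using m by (simp add: y_def exp_of_nat_mult[symmetric])
        also have "\<dots> \<le> (1 / y) ^ m"
        proof (intro power_mono)
          have "y \<le> exp y" using exp_ge_add_one_self[of y] by linarith
          then show "exp (- y) \<le> 1 / y" using y by (simp add: exp_minus field_simps)
        qed simp
        finally have "exp (- (\<kappa> * x)) \<le> (real m / (\<kappa> * x)) ^ m" by (simp add: y_def)
        then show ?thesis using C by (intro mult_left_mono add_left_mono) auto
      qed
      also have "C * (C\<^sub>1 / (\<eta> * x) ^ m + (real m / (\<kappa> * x)) ^ m) = B / x ^ m"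
        using x C by (simp add: B_def power_mult_distrib power_divide field_simps)
      also have "\<dots> = (sqrt B / x ^ j)\<^sup>2"
        using B by (simp add: power_divide m_def mult.commute flip: power_mult)
      finally show ?thesis
        unfolding x_def[symmetric] by (rule power2_le_imp_le) (use B x in auto)
    qed
    then show "\<exists>C>0. \<forall>n t. 0 \<le> t \<longrightarrow> real_of_int n > (2 + V\<^sub>0) * t \<longrightarrow> cmod (R n t) \<le> C / real_of_int n ^ j"
      using B by (intro exI[of _ "sqrt B"]) auto
  next
    assume an: "analytic_on_circle r"
    obtain d where d: "d > 0" "\<And>A. finite A \<Longrightarrow> d \<le> (\<Prod>n\<in>A. 1 - (cmod (R n 0))\<^sup>2)"
      using initial_prod_ge by blast
    interpret S: AL_scattering "\<lambda>n. R n 0" r "C\<^sub>2 * Z" d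
      by unfold_locales (use small summ d refl in auto)
    obtain \<sigma> G where \<sigma>: "0 < \<sigma>" "\<sigma> < 1" and G: "G > 0"
      and dec: "\<And>n. n \<ge> 0 \<Longrightarrow> cmod (R n 0) \<le> G * \<sigma> ^ nat n"
      using S.potential_exponential_decay[OF an] by blast
    \<comment> \<open>The slower of two rates: the tail of the initial data beyond
      \<open>\<eta> * x\<close> and the error of the light cone estimate.\<close>
    define \<tau> where "\<tau> = max (\<sigma> powr \<eta>) (exp (- \<kappa>))"
    have \<tau>: "0 < \<tau>" "\<tau> < 1"
      using \<sigma> C by (auto simp: \<tau>_def less_max_iff_disj powr01_less_one)
    \<comment> \<open>The root undoes the square in the light cone estimate.\<close>
    define \<rho> where "\<rho> = sqrt \<tau>"
    have \<rho>: "0 < \<rho>" "\<rho> < 1" using \<tau> by (auto simp: \<rho>_def)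
    define B where "B = C * (G + 1)"
    have B: "B > 0" using C G by (simp add: B_def)
    have "cmod (R N t) \<le> sqrt B * \<rho> powr real_of_int N"
      if t: "0 \<le> t" and N: "real_of_int N > (2 + V\<^sub>0) * t" for N t
    proof -
      define x where "x = real_of_int N"
      have x: "x > 0" using posN[OF t N] by (simp add: x_def)
      have s\<tau>: "\<sigma> powr (\<eta> * x) \<le> \<tau> powr x" "exp (- (\<kappa> * x)) \<le> \<tau> powr x"
      proof -
        have "(\<sigma> powr \<eta>) powr x \<le> \<tau> powr x" using x by (intro powr_mono2) (auto simp: \<tau>_def)
        then show "\<sigma> powr (\<eta> * x) \<le> \<tau> powr x" by (simp add: powr_powr)
        have "exp (- \<kappa>) powr x \<le> \<tau> powr x" using x by (intro powr_mono2) (auto simp: \<tau>_def)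
        then show "exp (- (\<kappa> * x)) \<le> \<tau> powr x" by (simp add: powr_def mult.commute)
      qed
      have "cmod (R k 0) \<le> G * \<sigma> powr (\<eta> * x)" if k: "real_of_int k \<ge> \<eta> * x" for k
      proof -
        have "\<eta> * x > 0" using C x by simp
        then have k0: "k \<ge> 0" using k by linarith
        have "\<sigma> ^ nat k = \<sigma> powr real_of_int k" using \<sigma> k0 by (simp add: powr_realpow[symmetric])
        also have "\<dots> \<le> \<sigma> powr (\<eta> * x)" using k \<sigma> by (intro powr_mono') auto
        finally show ?thesis using dec[OF k0] G by (smt (verit) mult_left_mono)
      qed
      then have "(cmod (R N t))\<^sup>2 \<le> C * (G * \<sigma> powr (\<eta> * x) + exp (- (\<kappa> * x)))"
        using cone[OF t N, of "G * \<sigma> powr (\<eta> * x)"] G unfolding x_def by auto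
      also have "\<dots> \<le> C * (G * \<tau> powr x + \<tau> powr x)"
        using s\<tau> C G by (intro mult_left_mono add_mono) auto
      also have "\<dots> = B * \<tau> powr x" by (simp add: B_def algebra_simps)
      also have "\<dots> = (sqrt B * \<rho> powr x)\<^sup>2"
      proof -
        have "(\<rho> powr x)\<^sup>2 = (\<rho> * \<rho>) powr x"
          using \<rho> by (simp add: power2_eq_square powr_mult)
        also have "\<rho> * \<rho> = \<tau>" using \<tau> by (simp add: \<rho>_def)
        finally show ?thesis using B by (simp add: power_mult_distrib)
      qed
      finally show ?thesis
        unfolding x_def[symmetric] by (rule power2_le_imp_le) (use B in auto)
    qed
    then show "\<exists>\<rho> C. 0 < \<rho> \<and> \<rho> < 1 \<and> C > 0 \<and>
               (\<forall>n t. 0 \<le> t \<longrightarrow> real_of_int n > (2 + V\<^sub>0) * t \<longrightarrow>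
                  cmod (R n t) \<le> C * \<rho> powr real_of_int n)"
      using B \<rho> by (intro exI[of _ \<rho>] exI[of _ "sqrt B"]) auto
  qed
qed

end
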